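(* The theory $\mathsf{PA}^-+\mathsf{UF}$ has a completion that is axiomatised by a single sentence $\Phi$ plus a set of $\Sigma_1$-sentences. Specifically, this completion can be taken to be the complete theory $\mathrm{Th}(\mathbb M)$ of the structure $\mathbb M=\mathbb Z[X]^{\geq 0}$.
   Context: The language of arithmetic has signature $\{0,1,+,\times,<\}$. $\mathsf{PA}^-$ is the theory of non-negative parts of discretely ordered commutative rings, axiomatised by (the universal closures of): $(x+y)+z=x+(y+z)$; $x+y=y+x$; $(xy)z=x(yz)$; $xy=yx$; $x(y+z)=xy+xz$; $x+0=x\wedge x\cdot 0=0$; $x\cdot 1=x$; $(x<y\wedge y<z)\to x<z$; $\neg\,x<x$; $x<y\vee x=y\vee y<x$; $x<y\to x+z<y+z$; $(0<z\wedge x<y)\to xz<yz$; $x<y\to\exists z\,(x+z=y)$; $0<1\wedge(0<x\to(x=1\vee 1<x))$; $x=0\vee 0<x$. A formula is $\Delta_0$ if all its quantifiers are bounded. A $\Sigma_1$-formula is a $\Delta_0$-formula prefixed by a (possibly empty) block of existential quantifiers. A completion of $T$ is a consistent complete theory in the same language extending $T$. $\mathbb M=\mathbb Z[X]^{\ge 0}$ is the non-negative part of the ordered polynomial ring $\mathbb Z[X]$, where a nonzero polynomial is positive iff its leading coefficient is positive (so $X$ exceeds every integer). Sequence coding in $\mathsf{PA}^-$: $\langle x,y\rangle:=(x+y)^2+x$. $\beta(x,i,w)$ holds iff $\exists u,v,q\,(w=\langle u,v\rangle\wedge u=q(1+(i+1)v)+x\wedge x\le (i+1)v)$; for given $i,w$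 there is at most one such $x$. A $\ast$-sequence is an $s$ of the form $\langle n,w\rangle$ with $\forall i<n\,\exists x\le w\;\beta(x,i,w)$; then $\mathrm{length}(s)=n$, and for $i<n$, $\pi(s,i)$ is the unique $x$ with $\beta(x,i,w)$. $\mathsf{pseq}^\ast(s)$ says: $s$ is a $\ast$-sequence, all its elements $\pi(s,i)$ ($i<\mathrm{length}(s)$) are prime, and $\pi(s,i)\le\pi(s,j)$ whenever $i<j<\mathrm{length}(s)$. $s\approx s'$ says: $\mathrm{length}(s)=\mathrm{length}(s')$ and $\pi(s,i)=\pi(s',i)$ for all $i<\mathrm{length}(s)$. $\Pi$ is the partial function giving the product of the elements of a $\ast$-sequence: $\Pi(s)=x$ iff there is a $\ast$-sequence $t$ of length $\mathrm{length}(s)+1$ with $\pi(t,0)=1$, $\pi(t,i+1)=\pi(t,i)\cdot\pi(s,i)$ for all $i<\mathrm{length}(s)$, and $\pi(t,\mathrm{length}(s))=x$. $\mathsf{UF}$ (unique factorisation) is the sentence: for all $x>0$ there is $s$ with $\mathsf{pseq}^\ast(s)$ such that for all $s'$ with $\mathsf{pseq}^\ast(s')$: $\Pi(s')=x\leftrightarrow s\approx s'$. *)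

theory Defs
  imports "HOL-Computational_Algebra.Polynomial" "HOL-Library.Countable_Set"
begin

section \<open>First-order logic with equality in the language of arithmetic\<close>

text \<open>Variables are de Bruijn indices.\<close>

datatype tm = Var nat | Zero | One | Add tm tm | Mul tm tm

datatype fm =
    Eq tm tm
  | Lt tm tm
  | Neg fm
  | And fm fm
  | Or fm fm
  | Imp fm fm
  | Forall fm
  | Exists fm

abbreviation Iff :: "fm \<Rightarrow> fm \<Rightarrow> fm" where
  "Iff p q \<equiv> And (Imp p q) (Imp q p)"

abbreviation Le :: "tm \<Rightarrow> tm \<Rightarrow> fm" where
  "Le s t \<equiv> Or (Lt s t) (Eq s t)"

text \<open>\<open>shift n t\<close> is \<open>t\<close> transported under \<open>n\<close> further quantifiers.\<close>

primrec shift :: "nat \<Rightarrow> tm \<Rightarrow> tm" where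
  "shift n (Var i) = Var (i + n)"
| "shift n Zero = Zero"
| "shift n One = One"
| "shift n (Add s t) = Add (shift n s) (shift n t)"
| "shift n (Mul s t) = Mul (shift n s) (shift n t)"

abbreviation AllLt :: "tm \<Rightarrow> fm \<Rightarrow> fm" where
  "AllLt t p \<equiv> Forall (Imp (Lt (Var 0) (shift 1 t)) p)"

abbreviation ExLt :: "tm \<Rightarrow> fm \<Rightarrow> fm" where
  "ExLt t p \<equiv> Exists (And (Lt (Var 0) (shift 1 t)) p)"

abbreviation ExLe :: "tm \<Rightarrow> fm \<Rightarrow> fm" where
  "ExLe t p \<equiv> Exists (And (Le (Var 0) (shift 1 t)) p)"

primrec tm_below :: "nat \<Rightarrow> tm \<Rightarrow> bool" where
  "tm_below n (Var i) \<longleftrightarrow> i < n"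
| "tm_below n Zero \<longleftrightarrow> True"
| "tm_below n One \<longleftrightarrow> True"
| "tm_below n (Add s t) \<longleftrightarrow> tm_below n s \<and> tm_below n t"
| "tm_below n (Mul s t) \<longleftrightarrow> tm_below n s \<and> tm_below n t"

text \<open>\<open>fm_below n p\<close>: the free variables of \<open>p\<close> have index below \<open>n\<close>.\<close>

primrec fm_below :: "nat \<Rightarrow> fm \<Rightarrow> bool" where
  "fm_below n (Eq s t) \<longleftrightarrow> tm_below n s \<and> tm_below n t"
| "fm_below n (Lt s t) \<longleftrightarrow> tm_below n s \<and> tm_below n t"
| "fm_below n (Neg p) \<longleftrightarrow> fm_below n p"
| "fm_below n (And p q) \<longleftrightarrow> fm_below n p \<and> fm_below n q"
| "fm_below n (Or p q) \<longleftrightarrow> fm_below n p \<and> fm_below n q"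
| "fm_below n (Imp p q) \<longleftrightarrow> fm_below n p \<and> fm_below n q"
| "fm_below n (Forall p) \<longleftrightarrow> fm_below (Suc n) p"
| "fm_below n (Exists p) \<longleftrightarrow> fm_below (Suc n) p"

definition sentence :: "fm \<Rightarrow> bool" where
  "sentence p \<longleftrightarrow> fm_below 0 p"

text \<open>The bound of a bounded quantifier is shifted, hence free of the quantified variable.\<close>

inductive delta0 :: "fm \<Rightarrow> bool" where
  "delta0 (Eq s t)"
| "delta0 (Lt s t)"
| "delta0 p \<Longrightarrow> delta0 (Neg p)"
| "delta0 p \<Longrightarrow> delta0 q \<Longrightarrow> delta0 (And p q)"
| "delta0 p \<Longrightarrow> delta0 q \<Longrightarrow> delta0 (Or p q)"
| "delta0 p \<Longrightarrow> delta0 q \<Longrightarrow> delta0 (Imp p q)"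
| "delta0 p \<Longrightarrow> delta0 (AllLt t p)"
| "delta0 p \<Longrightarrow> delta0 (ExLt t p)"

inductive sigma1 :: "fm \<Rightarrow> bool" where
  "delta0 p \<Longrightarrow> sigma1 p"
| "sigma1 p \<Longrightarrow> sigma1 (Exists p)"

record 'a interp =
  universe :: "'a set"
  zero :: 'a
  one :: 'a
  add :: "'a \<Rightarrow> 'a \<Rightarrow> 'a"
  mul :: "'a \<Rightarrow> 'a \<Rightarrow> 'a"
  lt :: "'a \<Rightarrow> 'a \<Rightarrow> bool"

definition is_interp :: "'a interp \<Rightarrow> bool" where
  "is_interp A \<longleftrightarrow> zero A \<in> universe A \<and> one A \<in> universe A \<and>
     (\<forall>x\<in>universe A. \<forall>y\<in>universe A. add A x y \<in> universe A \<and> mul A x y \<in> universe A)"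

primrec eval :: "'a interp \<Rightarrow> (nat \<Rightarrow> 'a) \<Rightarrow> tm \<Rightarrow> 'a" where
  "eval A e (Var i) = e i"
| "eval A e Zero = zero A"
| "eval A e One = one A"
| "eval A e (Add s t) = add A (eval A e s) (eval A e t)"
| "eval A e (Mul s t) = mul A (eval A e s) (eval A e t)"

primrec sat :: "'a interp \<Rightarrow> (nat \<Rightarrow> 'a) \<Rightarrow> fm \<Rightarrow> bool" where
  "sat A e (Eq s t) \<longleftrightarrow> eval A e s = eval A e t"
| "sat A e (Lt s t) \<longleftrightarrow> lt A (eval A e s) (eval A e t)"
| "sat A e (Neg p) \<longleftrightarrow> \<not> sat A e p"
| "sat A e (And p q) \<longleftrightarrow> sat A e p \<and> sat A e q"
| "sat A e (Or p q) \<longleftrightarrow> sat A e p \<or> sat A e q"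
| "sat A e (Imp p q) \<longleftrightarrow> (sat A e p \<longrightarrow> sat A e q)"
| "sat A e (Forall p) \<longleftrightarrow> (\<forall>a\<in>universe A. sat A (case_nat a e) p)"
| "sat A e (Exists p) \<longleftrightarrow> (\<exists>a\<in>universe A. sat A (case_nat a e) p)"

definition holds :: "'a interp \<Rightarrow> fm \<Rightarrow> bool" where
  "holds A p \<longleftrightarrow> (\<forall>e. range e \<subseteq> universe A \<longrightarrow> sat A e p)"

definition Th :: "'a interp \<Rightarrow> fm set" where
  "Th A = {p. sentence p \<and> holds A p}"

text \<open>
  Logical consequence. HOL cannot quantify over the types of structures inside a formula, so the
  definition ranges over the structures whose domain is a (finite or infinite) set of natural
  numbers. For sentences this loses nothing, by the downward Loewenheim-Skolem theorem: see
  \<open>entails_any_interp\<close> below, where the type of structures is arbitrary.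
\<close>

definition entails :: "fm set \<Rightarrow> fm \<Rightarrow> bool" where
  "entails T p \<longleftrightarrow>
     (\<forall>A :: nat interp. is_interp A \<longrightarrow> (\<forall>q\<in>T. holds A q) \<longrightarrow> holds A p)"

definition consistent :: "fm set \<Rightarrow> bool" where
  "consistent T \<longleftrightarrow> \<not> (\<exists>p. sentence p \<and> entails T p \<and> entails T (Neg p))"

definition complete_theory :: "fm set \<Rightarrow> bool" where
  "complete_theory T \<longleftrightarrow> (\<forall>p. sentence p \<longrightarrow> entails T p \<or> entails T (Neg p))"

definition is_theory :: "fm set \<Rightarrow> bool" where
  "is_theory T \<longleftrightarrow> (\<forall>p\<in>T. sentence p) \<and> (\<forall>p. sentence p \<longrightarrow> entails T p \<longrightarrow> p \<in> T)"

definition completion_of :: "fm set \<Rightarrow> fm set \<Rightarrow> bool" where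
  "completion_of T U \<longleftrightarrow> is_theory U \<and> consistent U \<and> complete_theory U \<and> T \<subseteq> U"

definition axiomatised_by :: "fm set \<Rightarrow> fm set \<Rightarrow> bool" where
  "axiomatised_by U Ax \<longleftrightarrow> U = {p. sentence p \<and> entails Ax p}"


section \<open>Logical consequence does not depend on the type of structures\<close>

lemma eval_cong:
  "tm_below n t \<Longrightarrow> (\<And>i. i < n \<Longrightarrow> e i = e' i) \<Longrightarrow> eval A e t = eval A e' t"
  by (induction t) auto

lemma sat_cong:
  "fm_below n p \<Longrightarrow> (\<And>i. i < n \<Longrightarrow> e i = e' i) \<Longrightarrow> sat A e p = sat A e' p"
proof (induction p arbitrary: n e e')
  case (Eq s t)
  then show ?case using eval_cong[of n _ e e' A] by auto
next
  case (Lt s t)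
  then show ?case using eval_cong[of n _ e e' A] by auto
next
  case (Neg p)
  then show ?case by (metis fm_below.simps(3) sat.simps(3))
next
  case (And p q)
  then show ?case by (metis fm_below.simps(4) sat.simps(4))
next
  case (Or p q)
  then show ?case by (metis fm_below.simps(5) sat.simps(5))
next
  case (Imp p q)
  then show ?case by (metis fm_below.simps(6) sat.simps(6))
next
  case (Forall p)
  have "sat A (case_nat a e) p = sat A (case_nat a e') p" for a
    by (rule Forall.IH[of "Suc n"]) (use Forall.prems in \<open>auto split: nat.split\<close>)
  then show ?case by simp
next
  case (Exists p)
  have "sat A (case_nat a e) p = sat A (case_nat a e') p" for a
    by (rule Exists.IH[of "Suc n"]) (use Exists.prems in \<open>auto split: nat.split\<close>)
  then show ?case by simp
qed

lemma holds_sentence: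
  assumes "sentence p" "range e \<subseteq> universe A"
  shows "holds A p \<longleftrightarrow> sat A e p"
  using assms sat_cong[of 0 p] unfolding holds_def sentence_def by blast

lemma tm_below_mono: "tm_below m t \<Longrightarrow> m \<le> n \<Longrightarrow> tm_below n t"
  by (induction t) auto

lemma fm_below_mono: "fm_below m p \<Longrightarrow> m \<le> n \<Longrightarrow> fm_below n p"
proof (induction p arbitrary: m n)
  case (Forall p)
  then show ?case by (metis Suc_le_mono fm_below.simps(7))
next
  case (Exists p)
  then show ?case by (metis Suc_le_mono fm_below.simps(8))
qed (use tm_below_mono in fastforce)+

lemma ex_tm_below: "\<exists>n. tm_below n t"
proof (induction t)
  case (Var i)
  show ?case by (rule exI[of _ "Suc i"]) simp
next
  case (Add s t)
  then obtain m n where "tm_below m s" "tm_below n t" by blast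
  then show ?case
    by (intro exI[of _ "max m n"]) (auto intro: tm_below_mono)
next
  case (Mul s t)
  then obtain m n where "tm_below m s" "tm_below n t" by blast
  then show ?case
    by (intro exI[of _ "max m n"]) (auto intro: tm_below_mono)
qed auto

lemma ex_tm_below2: "\<exists>n. tm_below n s \<and> tm_below n t"
proof -
  obtain m n where "tm_below m s" "tm_below n t" using ex_tm_below by blast
  then show ?thesis
    by (intro exI[of _ "max m n"]) (auto intro: tm_below_mono)
qed

lemma ex_fm_below: "\<exists>n. fm_below n p"
proof (induction p)
  case (And p q)
  then obtain m n where "fm_below m p" "fm_below n q" by blast
  then show ?case by (intro exI[of _ "max m n"]) (auto intro: fm_below_mono)
next
  case (Or p q)
  then obtain m n where "fm_below m p" "fm_below n q" by blast
  then show ?case by (intro exI[of _ "max m n"]) (auto intro: fm_below_mono)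
next
  case (Imp p q)
  then obtain m n where "fm_below m p" "fm_below n q" by blast
  then show ?case by (intro exI[of _ "max m n"]) (auto intro: fm_below_mono)
next
  case (Forall p)
  then obtain n where "fm_below n p" by blast
  then show ?case by (intro exI[of _ n]) (auto intro: fm_below_mono)
next
  case (Exists p)
  then obtain n where "fm_below n p" by blast
  then show ?case by (intro exI[of _ n]) (auto intro: fm_below_mono)
qed (use ex_tm_below2 in auto)

lemma eval_in_dom: "is_interp A \<Longrightarrow> range e \<subseteq> universe A \<Longrightarrow> eval A e t \<in> universe A"
  by (induction t) (auto simp: is_interp_def)

lemma range_case_nat: "a \<in> D \<Longrightarrow> range e \<subseteq> D \<Longrightarrow> range (case_nat a e) \<subseteq> D"
  by (auto simp: image_subset_iff split: nat.split)

lemma Tarski_Vaught: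
  fixes A :: "'a interp"
  assumes A: "is_interp A" and H: "H \<subseteq> universe A"
    and TV: "\<And>p e. range e \<subseteq> H \<Longrightarrow> \<exists>a\<in>universe A. sat A (case_nat a e) p \<Longrightarrow>
              \<exists>a\<in>H. sat A (case_nat a e) p"
  shows "range e \<subseteq> H \<Longrightarrow> sat (A\<lparr>universe := H\<rparr>) e p = sat A e p"
proof -
  have ev: "eval (A\<lparr>universe := H\<rparr>) e t = eval A e t" for e t
    by (induction t) auto
  show "range e \<subseteq> H \<Longrightarrow> sat (A\<lparr>universe := H\<rparr>) e p = sat A e p"
  proof (induction p arbitrary: e)
    case (Forall p)
    have "sat (A\<lparr>universe := H\<rparr>) e (Forall p) \<longleftrightarrow> (\<forall>a\<in>H. sat A (case_nat a e) p)"
      using Forall.IH[OF range_case_nat[OF _ Forall.prems]] by simp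
    also have "\<dots> \<longleftrightarrow> (\<forall>a\<in>universe A. sat A (case_nat a e) p)"
      using TV[OF Forall.prems, of "Neg p"] H by auto
    finally show ?case by simp
  next
    case (Exists p)
    have "sat (A\<lparr>universe := H\<rparr>) e (Exists p) \<longleftrightarrow> (\<exists>a\<in>H. sat A (case_nat a e) p)"
      using Exists.IH[OF range_case_nat[OF _ Exists.prems]] by simp
    also have "\<dots> \<longleftrightarrow> (\<exists>a\<in>universe A. sat A (case_nat a e) p)"
      using TV[OF Exists.prems, of p] H by auto
    finally show ?case by simp
  qed (auto simp: ev)
qed

instance tm :: countable by countable_datatype
instance fm :: countable by countable_datatype

lemma Loewenheim_Skolem:
  fixes A :: "'a interp"
  assumes A: "is_interp A"
  obtains H where "countable H" "is_interp (A\<lparr>universe := H\<rparr>)"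
    "\<And>p. sentence p \<Longrightarrow> holds (A\<lparr>universe := H\<rparr>) p = holds A p"
proof -
  define env where "env xs = (\<lambda>i. if i < length xs then xs ! i else zero A)" for xs
  define wit where "wit p xs = (if \<exists>a\<in>universe A. sat A (case_nat a (env xs)) p
     then SOME a. a \<in> universe A \<and> sat A (case_nat a (env xs)) p else zero A)" for p xs
  define step where "step H = H \<union> (\<lambda>(p, xs). wit p xs) ` (UNIV \<times> lists H)" for H
  define G where "G n = (step ^^ n) {}" for n
  define H where "H = (\<Union>n. G n)"
  have z: "zero A \<in> universe A" using A by (simp add: is_interp_def)
  have wit_dom: "wit p xs \<in> universe A" for p xs
    unfolding wit_def using z by (auto intro: someI2_ex)
  have wit_sat: "sat A (case_nat (wit p xs) (env xs)) p"
    if "\<exists>a\<in>universe A. sat A (case_nat a (env xs)) p" for p xs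
    unfolding wit_def using that by (auto intro: someI2_ex)
  have GSuc: "G (Suc n) = step (G n)" for n by (simp add: G_def)
  have Gc: "countable (G n)" for n
    by (induction n) (auto simp: G_def step_def intro!: countable_image countable_SIGMA countable_lists)
  have Gd: "G n \<subseteq> universe A" for n
    by (induction n) (use wit_dom in \<open>auto simp: G_def step_def\<close>)
  have Gmono: "mono G"
    by (rule incseq_SucI) (auto simp: GSuc step_def)
  have Hc: "countable H" unfolding H_def using Gc by blast
  have Hd: "H \<subseteq> universe A" unfolding H_def using Gd by blast
  have Hlists: "\<exists>n. xs \<in> lists (G n)" if "xs \<in> lists H" for xs
    using that
  proof (induction xs)
    case Nil
    then show ?case by auto
  next
    case (Cons x xs)
    then obtain m n where "x \<in> G m" "xs \<in> lists (G n)" by (auto simp: H_def)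
    moreover have "G m \<subseteq> G (max m n)" "G n \<subseteq> G (max m n)"
      using Gmono by (simp_all add: monoD)
    ultimately show ?case by (intro exI[of _ "max m n"]) auto
  qed
  have witH: "wit p xs \<in> H" if xs: "xs \<in> lists H" for p xs
  proof -
    obtain n where n: "xs \<in> lists (G n)" using Hlists[OF xs] by blast
    have "wit p xs \<in> G (Suc n)" unfolding GSuc step_def using n by force
    then show ?thesis by (auto simp: H_def)
  qed
  have TV: "\<exists>a\<in>H. sat A (case_nat a e) p"
    if e: "range e \<subseteq> H" and ex: "\<exists>a\<in>universe A. sat A (case_nat a e) p" for p e
  proof -
    obtain n where n: "fm_below n p" using ex_fm_below by blast
    define xs where "xs = map e [0..<n]"
    have xs: "xs \<in> lists H" using e by (auto simp: xs_def image_subset_iff)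
    have eq: "sat A (case_nat a e) p = sat A (case_nat a (env xs)) p" for a
      by (rule sat_cong[OF n]) (auto simp: env_def xs_def split: nat.split)
    show ?thesis using ex witH[OF xs, of p] wit_sat[of xs p] unfolding eq by blast
  qed
  have Hne: "wit (Eq Zero Zero) [] \<in> H" by (rule witH) simp
  have Hcl: "is_interp (A\<lparr>universe := H\<rparr>)"
  proof -
    have val: "eval A e t \<in> H" if e: "range e \<subseteq> H" for e t
    proof -
      have s: "eval A (case_nat a e) (shift 1 t) = eval A e t" for a
        by (induction t) auto
      have "eval A e t \<in> universe A" using eval_in_dom[OF A] e Hd by blast
      then show ?thesis using TV[OF e, of "Eq (Var 0) (shift 1 t)"] s by auto
    qed
    have "zero A \<in> H" "one A \<in> H"
      using val[of "\<lambda>_. wit (Eq Zero Zero) []" Zero]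
        val[of "\<lambda>_. wit (Eq Zero Zero) []" One] Hne by auto
    moreover have "add A x y \<in> H \<and> mul A x y \<in> H" if "x \<in> H" "y \<in> H" for x y
    proof -
      have "range (case_nat x (\<lambda>_. y)) \<subseteq> H"
        using that by (intro range_case_nat) auto
      then show ?thesis
        using val[of "case_nat x (\<lambda>_. y)" "Add (Var 0) (Var 1)"]
          val[of "case_nat x (\<lambda>_. y)" "Mul (Var 0) (Var 1)"] by simp
    qed
    ultimately show ?thesis by (simp add: is_interp_def)
  qed
  have "holds (A\<lparr>universe := H\<rparr>) p = holds A p" if p: "sentence p" for p
  proof -
    define e where "e = (\<lambda>_::nat. wit (Eq Zero Zero) [])"
    have e: "range e \<subseteq> H" using Hne by (auto simp: e_def)
    have "holds (A\<lparr>universe := H\<rparr>) p = sat (A\<lparr>universe := H\<rparr>) e p"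
      by (rule holds_sentence[OF p]) (use e in simp)
    also have "\<dots> = sat A e p" by (rule Tarski_Vaught[OF A Hd TV e])
    also have "\<dots> = holds A p"
      by (rule holds_sentence[OF p, symmetric]) (use e Hd in blast)
    finally show ?thesis .
  qed
  then show thesis using that[OF Hc Hcl] by blast
qed

definition image_interp :: "('a \<Rightarrow> 'b) \<Rightarrow> 'a interp \<Rightarrow> 'b interp" where
  "image_interp f A = (let g = inv_into (universe A) f in
     \<lparr>universe = f ` universe A, zero = f (zero A), one = f (one A),
      add = (\<lambda>x y. f (add A (g x) (g y))), mul = (\<lambda>x y. f (mul A (g x) (g y))),
      lt = (\<lambda>x y. lt A (g x) (g y))\<rparr>)"

lemma image_interp:
  assumes A: "is_interp A" and f: "inj_on f (universe A)"
  shows "is_interp (image_interp f A)"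
    and "sentence p \<Longrightarrow> holds (image_interp f A) p = holds A p"
proof -
  let ?B = "image_interp f A"
  have B: "universe ?B = f ` universe A" "zero ?B = f (zero A)" "one ?B = f (one A)"
    "\<And>x y. x \<in> universe A \<Longrightarrow> y \<in> universe A \<Longrightarrow> add ?B (f x) (f y) = f (add A x y)"
    "\<And>x y. x \<in> universe A \<Longrightarrow> y \<in> universe A \<Longrightarrow> mul ?B (f x) (f y) = f (mul A x y)"
    "\<And>x y. x \<in> universe A \<Longrightarrow> y \<in> universe A \<Longrightarrow> lt ?B (f x) (f y) = lt A x y"
    using f by (auto simp: image_interp_def Let_def)
  show "is_interp ?B"
    using A unfolding is_interp_def B(1) by (auto simp: B)
  have ev: "eval ?B (f \<circ> e) t = f (eval A e t)" if "range e \<subseteq> universe A" for e t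
  proof (induction t)
    case (Add s t)
    then show ?case using B(4) eval_in_dom[OF A that] by simp
  next
    case (Mul s t)
    then show ?case using B(5) eval_in_dom[OF A that] by simp
  qed (auto simp: B)
  have comp: "case_nat (f a) (f \<circ> e) = f \<circ> case_nat a e" for a e
    by (auto split: nat.split)
  have st: "range e \<subseteq> universe A \<Longrightarrow> sat ?B (f \<circ> e) p = sat A e p" for e p
  proof (induction p arbitrary: e)
    case (Eq s t)
    then show ?case
      unfolding sat.simps ev[OF Eq] using eval_in_dom[OF A Eq] inj_onD[OF f] by metis
  next
    case (Lt s t)
    then show ?case
      unfolding sat.simps ev[OF Lt] using eval_in_dom[OF A Lt] B(6) by metis
  next
    case (Forall p)
    have "sat ?B (case_nat (f a) (f \<circ> e)) p = sat A (case_nat a e) p" if "a \<in> universe A" for a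
      unfolding comp by (rule Forall.IH[OF range_case_nat[OF that Forall.prems]])
    then show ?case unfolding sat.simps B(1) by blast
  next
    case (Exists p)
    have "sat ?B (case_nat (f a) (f \<circ> e)) p = sat A (case_nat a e) p" if "a \<in> universe A" for a
      unfolding comp by (rule Exists.IH[OF range_case_nat[OF that Exists.prems]])
    then show ?case unfolding sat.simps B(1) by blast
  qed auto
  show "holds ?B p = holds A p" if p: "sentence p"
  proof -
    define e where "e = (\<lambda>_::nat. zero A)"
    have e: "range e \<subseteq> universe A" using A by (auto simp: e_def is_interp_def)
    then have "range (f \<circ> e) \<subseteq> universe ?B" by (auto simp: B)
    then show ?thesis
      using holds_sentence[OF p e] holds_sentence[OF p, of "f \<circ> e" ?B] st[OF e] by simp
  qed
qed

theorem entails_any_interp: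
  fixes A :: "'a interp"
  assumes ent: "entails T p" and T: "\<forall>q\<in>T. sentence q" and p: "sentence p"
    and A: "is_interp A" and AT: "\<forall>q\<in>T. holds A q"
  shows "holds A p"
proof -
  obtain H where H: "countable H" "is_interp (A\<lparr>universe := H\<rparr>)"
    "\<And>p. sentence p \<Longrightarrow> holds (A\<lparr>universe := H\<rparr>) p = holds A p"
    using Loewenheim_Skolem[OF A] by metis
  define f where "f = to_nat_on H"
  have inj: "inj_on f (universe (A\<lparr>universe := H\<rparr>))"
    using H(1) by (simp add: f_def inj_on_to_nat_on)
  let ?B = "image_interp f (A\<lparr>universe := H\<rparr>)"
  have B: "holds ?B q = holds A q" if "sentence q" for q
    using image_interp(2)[OF H(2) inj that] H(3)[OF that] by simp
  have "holds ?B p"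
    using ent image_interp(1)[OF H(2) inj] AT T B unfolding entails_def by blast
  then show ?thesis using B[OF p] by simp
qed


section \<open>Arithmetic\<close>

abbreviation Forall2 :: "fm \<Rightarrow> fm" where "Forall2 p \<equiv> Forall (Forall p)"
abbreviation Forall3 :: "fm \<Rightarrow> fm" where "Forall3 p \<equiv> Forall (Forall (Forall p))"

definition PA_minus :: "fm set" where
  "PA_minus =
    (let x = Var 0; y = Var 1; z = Var 2 in
     {Forall3 (Eq (Add (Add x y) z) (Add x (Add y z))),
      Forall2 (Eq (Add x y) (Add y x)),
      Forall3 (Eq (Mul (Mul x y) z) (Mul x (Mul y z))),
      Forall2 (Eq (Mul x y) (Mul y x)),
      Forall3 (Eq (Mul x (Add y z)) (Add (Mul x y) (Mul x z))),
      Forall (And (Eq (Add x Zero) x) (Eq (Mul x Zero) Zero)),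
      Forall (Eq (Mul x One) x),
      Forall3 (Imp (And (Lt x y) (Lt y z)) (Lt x z)),
      Forall (Neg (Lt x x)),
      Forall2 (Or (Or (Lt x y) (Eq x y)) (Lt y x)),
      Forall3 (Imp (Lt x y) (Lt (Add x z) (Add y z))),
      Forall3 (Imp (And (Lt Zero z) (Lt x y)) (Lt (Mul x z) (Mul y z))),
      Forall2 (Imp (Lt x y) (Exists (Eq (Add (shift 1 x) (Var 0)) (shift 1 y)))),
      Forall (And (Lt Zero One) (Imp (Lt Zero x) (Or (Eq x One) (Lt One x)))),
      Forall (Or (Eq x Zero) (Lt Zero x))})"

text \<open>
  The macros below take terms as arguments; arguments are shifted when they are placed under
  quantifiers. Each comes with its meaning in a structure. The partial functions
  \<open>length\<close>, \<open>\<pi>\<close> and \<open>\<Pi>\<close> are rendered by formulas defining their graphs.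
\<close>

definition pair_tm :: "tm \<Rightarrow> tm \<Rightarrow> tm" where
  "pair_tm x y = Add (Mul (Add x y) (Add x y)) x"

definition beta_fm :: "tm \<Rightarrow> tm \<Rightarrow> tm \<Rightarrow> fm" where
  "beta_fm x i w =
    (let u = Var 2; v = Var 1; q = Var 0; x = shift 3 x; i = shift 3 i; w = shift 3 w in
     Exists (Exists (Exists
      (And (Eq w (pair_tm u v))
      (And (Eq u (Add (Mul q (Add One (Mul (Add i One) v))) x))
           (Le x (Mul (Add i One) v)))))))"

text \<open>\<open>s = \<langle>n,w\<rangle>\<close> and \<open>s\<close> is a \<open>\<ast>\<close>-sequence.\<close>

definition seq_rep_fm :: "tm \<Rightarrow> tm \<Rightarrow> tm \<Rightarrow> fm" where
  "seq_rep_fm s n w =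
    And (Eq s (pair_tm n w))
        (AllLt n (ExLe (shift 1 w) (beta_fm (Var 0) (Var 1) (shift 2 w))))"

definition is_seq_fm :: "tm \<Rightarrow> fm" where
  "is_seq_fm s = Exists (Exists (seq_rep_fm (shift 2 s) (Var 1) (Var 0)))"

text \<open>\<open>s\<close> is a \<open>\<ast>\<close>-sequence with \<open>length(s) = n\<close>.\<close>

definition length_fm :: "tm \<Rightarrow> tm \<Rightarrow> fm" where
  "length_fm s n = Exists (seq_rep_fm (shift 1 s) (shift 1 n) (Var 0))"

text \<open>\<open>s\<close> is a \<open>\<ast>\<close>-sequence, \<open>i < length(s)\<close> and \<open>\<pi>(s,i) = x\<close>.\<close>

definition elem_fm :: "tm \<Rightarrow> tm \<Rightarrow> tm \<Rightarrow> fm" where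
  "elem_fm s i x =
    (let n = Var 1; w = Var 0; s = shift 2 s; i = shift 2 i; x = shift 2 x in
     Exists (Exists (And (seq_rep_fm s n w) (And (Lt i n) (beta_fm x i w)))))"

definition dvd_fm :: "tm \<Rightarrow> tm \<Rightarrow> fm" where
  "dvd_fm x y = Exists (Eq (Mul (shift 1 x) (Var 0)) (shift 1 y))"

text \<open>Primality in the sense of ring theory.\<close>

definition prime_fm :: "tm \<Rightarrow> fm" where
  "prime_fm p =
    And (Lt One p)
        (let x = Var 1; y = Var 0; p = shift 2 p in
         Forall2 (Imp (dvd_fm p (Mul x y)) (Or (dvd_fm p x) (dvd_fm p y))))"

definition pseq_fm :: "tm \<Rightarrow> fm" where
  "pseq_fm s =
    And (is_seq_fm s)
    (And (let i = Var 1; x = Var 0; s = shift 2 s in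
          Forall2 (Imp (elem_fm s i x) (prime_fm x)))
         (let i = Var 3; j = Var 2; x = Var 1; y = Var 0; s = shift 4 s in
          Forall2 (Forall2 (Imp (And (Lt i j) (And (elem_fm s i x) (elem_fm s j y))) (Le x y)))))"

definition approx_fm :: "tm \<Rightarrow> tm \<Rightarrow> fm" where
  "approx_fm s s' =
    Exists (And (And (length_fm (shift 1 s) (Var 0)) (length_fm (shift 1 s') (Var 0)))
        (AllLt (Var 0)
          (Exists (And (elem_fm (shift 3 s) (Var 1) (Var 0)) (elem_fm (shift 3 s') (Var 1) (Var 0))))))"

text \<open>\<open>\<Pi>(s) = x\<close>.\<close>

definition prod_fm :: "tm \<Rightarrow> tm \<Rightarrow> fm" where
  "prod_fm s x =
    (let n = Var 1; t = Var 0 in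
     Exists (Exists
      (And (length_fm (shift 2 s) n)
      (And (length_fm t (Add n One))
      (And (elem_fm t Zero One)
      (And (AllLt n
             (let t = shift 3 t; s = shift 5 s; i = Var 2; y = Var 1; z = Var 0 in
              Exists (Exists (And (elem_fm t i y)
                     (And (elem_fm s i z)
                          (elem_fm t (Add i One) (Mul y z)))))))
           (elem_fm t n (shift 2 x))))))))"

definition UF :: fm where
  "UF =
    Forall (Imp (Lt Zero (Var 0))
      (Exists (And (pseq_fm (Var 0))
        (let x = Var 2; s = Var 1; s' = Var 0 in
         Forall (Imp (pseq_fm s') (Iff (prod_fm s' x) (approx_fm s s')))))))"

text \<open>
  \<open>\<int>[X]\<^sup>\<ge>\<^sup>0\<close>. The order on polynomials is the library's, where \<open>p < q\<close> iff the leading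
  coefficient of \<open>q - p\<close> is positive.
\<close>

definition ZX_nonneg :: "int poly interp" where
  "ZX_nonneg =
    \<lparr>universe = {p. 0 \<le> p}, zero = 0, one = 1, add = (+), mul = (*), lt = (<)\<rparr>"


subsection \<open>The formulas read in a structure\<close>

lemma eval_shift [simp]:
  "eval A (case_nat a e) (shift (Suc n) t) = eval A e (shift n t)"
  by (induction t) auto

lemma shift_0 [simp]: "shift 0 t = t"
  by (induction t) auto

lemma shift_shift [simp]: "shift m (shift n t) = shift (m + n) t"
  by (induction t) auto

definition pair :: "'a interp \<Rightarrow> 'a \<Rightarrow> 'a \<Rightarrow> 'a" where
  "pair A x y = add A (mul A (add A x y) (add A x y)) x"

definition beta :: "'a interp \<Rightarrow> 'a \<Rightarrow> 'a \<Rightarrow> 'a \<Rightarrow> bool" where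
  "beta A x i w \<longleftrightarrow> (\<exists>u\<in>universe A. \<exists>v\<in>universe A. \<exists>q\<in>universe A. w = pair A u v \<and>
     u = add A (mul A q (add A (one A) (mul A (add A i (one A)) v))) x \<and>
     (lt A x (mul A (add A i (one A)) v) \<or> x = mul A (add A i (one A)) v))"

definition seq_rep :: "'a interp \<Rightarrow> 'a \<Rightarrow> 'a \<Rightarrow> 'a \<Rightarrow> bool" where
  "seq_rep A s n w \<longleftrightarrow> s = pair A n w \<and>
     (\<forall>i\<in>universe A. lt A i n \<longrightarrow> (\<exists>x\<in>universe A. (lt A x w \<or> x = w) \<and> beta A x i w))"

definition is_seq :: "'a interp \<Rightarrow> 'a \<Rightarrow> bool" where
  "is_seq A s \<longleftrightarrow> (\<exists>n\<in>universe A. \<exists>w\<in>universe A. seq_rep A s n w)"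

definition has_length :: "'a interp \<Rightarrow> 'a \<Rightarrow> 'a \<Rightarrow> bool" where
  "has_length A s n \<longleftrightarrow> (\<exists>w\<in>universe A. seq_rep A s n w)"

definition has_elem :: "'a interp \<Rightarrow> 'a \<Rightarrow> 'a \<Rightarrow> 'a \<Rightarrow> bool" where
  "has_elem A s i x \<longleftrightarrow>
     (\<exists>n\<in>universe A. \<exists>w\<in>universe A. seq_rep A s n w \<and> lt A i n \<and> beta A x i w)"

definition divides :: "'a interp \<Rightarrow> 'a \<Rightarrow> 'a \<Rightarrow> bool" where
  "divides A x y \<longleftrightarrow> (\<exists>z\<in>universe A. mul A x z = y)"

definition is_prime :: "'a interp \<Rightarrow> 'a \<Rightarrow> bool" where
  "is_prime A p \<longleftrightarrow> lt A (one A) p \<and>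
     (\<forall>x\<in>universe A. \<forall>y\<in>universe A. divides A p (mul A x y) \<longrightarrow> divides A p x \<or> divides A p y)"

definition pseq :: "'a interp \<Rightarrow> 'a \<Rightarrow> bool" where
  "pseq A s \<longleftrightarrow> is_seq A s \<and>
     (\<forall>i\<in>universe A. \<forall>x\<in>universe A. has_elem A s i x \<longrightarrow> is_prime A x) \<and>
     (\<forall>i\<in>universe A. \<forall>j\<in>universe A. \<forall>x\<in>universe A. \<forall>y\<in>universe A.
        lt A i j \<and> has_elem A s i x \<and> has_elem A s j y \<longrightarrow> lt A x y \<or> x = y)"

definition approx :: "'a interp \<Rightarrow> 'a \<Rightarrow> 'a \<Rightarrow> bool" where
  "approx A s s' \<longleftrightarrow> (\<exists>n\<in>universe A. has_length A s n \<and> has_length A s' n \<and>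
     (\<forall>i\<in>universe A. lt A i n \<longrightarrow> (\<exists>x\<in>universe A. has_elem A s i x \<and> has_elem A s' i x)))"

definition has_prod :: "'a interp \<Rightarrow> 'a \<Rightarrow> 'a \<Rightarrow> bool" where
  "has_prod A s x \<longleftrightarrow> (\<exists>n\<in>universe A. \<exists>t\<in>universe A.
     has_length A s n \<and> has_length A t (add A n (one A)) \<and> has_elem A t (zero A) (one A) \<and>
     (\<forall>i\<in>universe A. lt A i n \<longrightarrow> (\<exists>y\<in>universe A. \<exists>z\<in>universe A.
        has_elem A t i y \<and> has_elem A s i z \<and> has_elem A t (add A i (one A)) (mul A y z))) \<and>
     has_elem A t n x)"

lemma eval_pair_tm [simp]: "eval A e (pair_tm x y) = pair A (eval A e x) (eval A e y)"
  by (simp add: pair_tm_def pair_def)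

lemma sat_beta_fm [simp]:
  "sat A e (beta_fm x i w) \<longleftrightarrow> beta A (eval A e x) (eval A e i) (eval A e w)"
  by (simp add: beta_fm_def beta_def Let_def eval_nat_numeral)

lemma sat_seq_rep_fm [simp]:
  "sat A e (seq_rep_fm s n w) \<longleftrightarrow> seq_rep A (eval A e s) (eval A e n) (eval A e w)"
  by (simp add: seq_rep_fm_def seq_rep_def Let_def eval_nat_numeral)

lemma sat_is_seq_fm [simp]: "sat A e (is_seq_fm s) \<longleftrightarrow> is_seq A (eval A e s)"
  by (simp add: is_seq_fm_def is_seq_def Let_def eval_nat_numeral)

lemma sat_length_fm [simp]:
  "sat A e (length_fm s n) \<longleftrightarrow> has_length A (eval A e s) (eval A e n)"
  by (simp add: length_fm_def has_length_def)

lemma sat_elem_fm [simp]: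
  "sat A e (elem_fm s i x) \<longleftrightarrow> has_elem A (eval A e s) (eval A e i) (eval A e x)"
  by (simp add: elem_fm_def has_elem_def Let_def eval_nat_numeral)

lemma sat_dvd_fm [simp]: "sat A e (dvd_fm x y) \<longleftrightarrow> divides A (eval A e x) (eval A e y)"
  by (simp add: dvd_fm_def divides_def)

lemma sat_prime_fm [simp]: "sat A e (prime_fm p) \<longleftrightarrow> is_prime A (eval A e p)"
  by (simp add: prime_fm_def is_prime_def Let_def eval_nat_numeral)

lemma sat_pseq_fm [simp]: "sat A e (pseq_fm s) \<longleftrightarrow> pseq A (eval A e s)"
  by (simp add: pseq_fm_def pseq_def Let_def eval_nat_numeral)

lemma sat_approx_fm [simp]:
  "sat A e (approx_fm s s') \<longleftrightarrow> approx A (eval A e s) (eval A e s')"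
  by (simp add: approx_fm_def approx_def Let_def eval_nat_numeral)

lemma sat_prod_fm [simp]:
  "sat A e (prod_fm s x) \<longleftrightarrow> has_prod A (eval A e s) (eval A e x)"
  by (simp add: prod_fm_def has_prod_def Let_def eval_nat_numeral)

lemma sat_UF:
  "sat A e UF \<longleftrightarrow>
     (\<forall>x\<in>universe A. lt A (zero A) x \<longrightarrow> (\<exists>s\<in>universe A. pseq A s \<and>
        (\<forall>s'\<in>universe A. pseq A s' \<longrightarrow> (has_prod A s' x \<longleftrightarrow> approx A s s'))))"
  by (auto simp: UF_def Let_def eval_nat_numeral iff_conv_conj_imp)

lemma tm_below_shift [simp]: "tm_below (n + m) (shift m t) = tm_below n t"
  by (induction t) auto

lemma sentence_UF: "sentence UF"
  by (simp add: UF_def sentence_def Let_def pseq_fm_def prod_fm_def approx_fm_def is_seq_fm_def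
      seq_rep_fm_def prime_fm_def elem_fm_def length_fm_def beta_fm_def dvd_fm_def pair_tm_def)

lemma sentence_PA_minus: "p \<in> PA_minus \<Longrightarrow> sentence p"
  by (auto simp: PA_minus_def sentence_def Let_def)

end

theory Submission
  imports Defs "HOL-Computational_Algebra.Polynomial_Factorial"
    "HOL-Computational_Algebra.Squarefree"
begin

text \<open>
  In \<open>\<int>[X]\<^sup>\<ge>\<^sup>0\<close> a product over a \<open>\<ast>\<close>-sequence of primes of nonstandard length would give
  exponentially growing remainders of one polynomial modulo \<open>1 + (i + 1) v\<close> for all standard \<open>i\<close>,
  which is impossible; so \<open>UF\<close> reduces to the factoriality of \<open>\<int>[X]\<close>.

  For the axiomatisation, the natural numbers are the cut \<open>{a. a < x \<and> a * a < x}\<close> for every \<open>x\<close>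
  satisfying a certain \<open>\<Delta>\<^sub>0\<close> condition, for instance \<open>x = X\<close>; hence the quantifiers of an
  arithmetical statement can be bounded by \<open>x\<close>. Polynomials can be coded by numbers in such a way
  that addition, multiplication and order are arithmetical: they are compared through their values
  at almost all numbers \<open>k\<close>, and the value of \<open>a\<close> at \<open>k\<close> is its residue modulo \<open>X - k\<close>. The
  sentence \<open>\<Phi>\<close> says that this coding is an isomorphism onto the whole structure. Under \<open>\<Phi>\<close>
  every sentence is translated into a bounded statement about the codes, whose truth in
  \<open>\<int>[X]\<^sup>\<ge>\<^sup>0\<close> is expressed by a \<open>\<Sigma>\<^sub>1\<close>-sentence.
\<close>

section \<open>Coding finite sequences by remainders\<close>

lemma comaximal_mult:
  fixes a b c :: "'a::comm_ring_1"
  assumes "\<exists>s t. s * a + t * c = 1" "\<exists>s t. s * b + t * c = 1"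
  shows "\<exists>s t. s * (a * b) + t * c = 1"
proof -
  obtain s t s' t' where 1: "s * a + t * c = 1" and 2: "s' * b + t' * c = 1"
    using assms by blast
  have "(s * s') * (a * b) + (s * a * t' + t * s' * b + t * t' * c) * c
      = (s * a + t * c) * (s' * b + t' * c)"
    by (simp add: algebra_simps)
  also have "\<dots> = 1" by (simp add: 1 2)
  finally show ?thesis by blast
qed

lemma comaximal_prod:
  fixes a :: "nat \<Rightarrow> 'a::comm_ring_1"
  assumes "\<And>i. i < m \<Longrightarrow> \<exists>s t. s * a i + t * c = 1"
  shows "\<exists>s t. s * (\<Prod>i<m. a i) + t * c = 1"
  using assms
proof (induction m)
  case 0
  have "1 * 1 + 0 * c = 1" by simp
  then show ?case by (metis lessThan_0 prod.empty)
next
  case (Suc m)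
  then have "\<exists>s t. s * ((\<Prod>i<m. a i) * a m) + t * c = 1"
    by (intro comaximal_mult) auto
  then show ?case by simp
qed

text \<open>Goedel's moduli: \<open>j + 1\<close> times the first minus \<open>i + 1\<close> times the second is \<open>j - i\<close>, which
  divides \<open>v\<close>.\<close>

lemma comaximal_moduli:
  fixes v :: "'a::comm_ring_1"
  assumes ij: "i < j" and dvd: "of_nat (j - i) dvd v"
  shows "\<exists>s t. s * (1 + (of_nat i + 1) * v) + t * (1 + (of_nat j + 1) * v) = 1"
proof -
  obtain e where e: "v = of_nat (j - i) * e" using dvd by (auto elim: dvdE)
  define d where "d = (\<lambda>i::nat. 1 + (of_nat i + 1) * v)"
  have "(of_nat j + 1) * d i - (of_nat i + 1) * d j = of_nat (j - i)"
    using ij by (simp add: d_def of_nat_diff algebra_simps)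
  then have "((of_nat j + 1) * d i - (of_nat i + 1) * d j) * e = v"
    using e by simp
  moreover have "d i = 1 + (of_nat i + 1) * v" by (simp add: d_def)
  ultimately have "d i - (of_nat i + 1) * (((of_nat j + 1) * d i - (of_nat i + 1) * d j) * e) = 1"
    by simp
  then have "(1 - (of_nat i + 1) * (of_nat j + 1) * e) * d i + ((of_nat i + 1) * (of_nat i + 1) * e) * d j = 1"
    by (simp add: algebra_simps)
  then show ?thesis unfolding d_def by blast
qed

text \<open>Induction on \<open>n\<close>: the last modulus is comaximal with the product of the
  earlier ones, so the residue at \<open>n\<close> can be corrected by a multiple of that
  product.\<close>

lemma chinese_remainder_moduli:
  fixes v :: "'a::comm_ring_1"
  assumes "\<And>j. 0 < j \<Longrightarrow> j < n \<Longrightarrow> of_nat j dvd v"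
  shows "\<exists>u. \<forall>i<n. 1 + (of_nat i + 1) * v dvd u - f i"
  using assms
proof (induction n)
  case (Suc n)
  define d where "d = (\<lambda>i::nat. 1 + (of_nat i + 1) * v)"
  obtain u where u: "\<And>i. i < n \<Longrightarrow> d i dvd u - f i"
    using Suc by (auto simp: d_def)
  have "\<exists>s t. s * (\<Prod>i<n. d i) + t * d n = 1"
    by (intro comaximal_prod) (unfold d_def, intro comaximal_moduli Suc.prems, auto)
  then obtain s t where st: "s * (\<Prod>i<n. d i) + t * d n = 1" by blast
  \<comment> \<open>The element \<open>s * (\<Prod>i<n. d i)\<close> is 0 modulo every earlier
    \<open>d i\<close> and 1 modulo \<open>d n\<close>.\<close>
  define u' where "u' = u + s * (\<Prod>i<n. d i) * (f n - u)"
  have "d i dvd u' - f i" if "i < Suc n" for i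
  proof (cases "i = n")
    case True
    have "s * (\<Prod>i<n. d i) = 1 - t * d n" using st by (metis add_diff_cancel_right')
    then have "u' - f n = d n * (t * (u - f n))"
      unfolding u'_def by (simp only:) (simp add: algebra_simps)
    then show ?thesis using True by simp
  next
    case False
    then have i: "i < n" using that by simp
    then have "d i dvd (\<Prod>i<n. d i)" by (intro dvd_prodI) auto
    moreover have "u' - f i = (u - f i) + s * (\<Prod>i<n. d i) * (f n - u)" by (simp add: u'_def)
    ultimately show ?thesis using u[OF i] by (metis dvd_add dvd_mult dvd_mult2)
  qed
  then show ?case unfolding d_def by blast
qed simp

text \<open>The generality over ordered domains serves two uses: sequences of polynomials in the
  structure itself, and sequences of integers in the numerical codes of polynomials.\<close>

lemma beta_coding:
  fixes f :: "nat \<Rightarrow> 'a::linordered_idom"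
  assumes f: "\<And>i. i < n \<Longrightarrow> 0 \<le> f i"
  shows "\<exists>u v. 0 \<le> u \<and> 0 \<le> v \<and> (\<forall>i<n. f i \<le> u \<and>
    (\<exists>q\<ge>0. u = q * (1 + (of_nat i + 1) * v) + f i \<and> f i \<le> (of_nat i + 1) * v))"
proof -
  define S where "S = (\<Sum>i<n. f i)"
  have S: "f i \<le> S" if "i < n" for i
    unfolding S_def using that f by (intro member_le_sum) auto
  have S0: "0 \<le> S" unfolding S_def using f by (intro sum_nonneg) auto
  \<comment> \<open>The factorial makes the moduli pairwise comaximal; the factor \<open>S\<close>
    makes \<open>v\<close> large enough for every \<open>f i\<close> to be a proper
    remainder.\<close>
  define v where "v = of_nat (fact n) * S"
  have v0: "0 \<le> v" using S0 by (simp add: v_def)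
  have Sv: "S \<le> v" unfolding v_def
    using mult_right_mono[of 1 "of_nat (fact n)" S] S0 by (simp add: fact_ge_1 del: of_nat_fact)
  define d where "d = (\<lambda>i::nat. 1 + (of_nat i + 1) * v)"
  have "of_nat j dvd v" if "0 < j" "j < n" for j
  proof -
    have "j dvd fact n" using that by (intro dvd_fact) auto
    then obtain k where "fact n = j * k" by (auto elim: dvdE)
    then show ?thesis unfolding v_def by (simp only: of_nat_mult mult.assoc dvd_triv_left)
  qed
  then obtain u where u: "\<And>i. i < n \<Longrightarrow> d i dvd u - f i"
    using chinese_remainder_moduli[of n v f] unfolding d_def by blast
  have d1: "1 \<le> d i" for i using v0 by (simp add: d_def)
  define P where "P = (\<Prod>i<n. d i)"
  have P1: "1 \<le> P" unfolding P_def using d1 by (intro prod_ge_1) auto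
  \<comment> \<open>Adding a multiple of all the moduli keeps the residues and lifts
    \<open>u\<close> above \<open>S\<close>, so that the quotients become nonnegative.\<close>
  define u' where "u' = u + P * (\<bar>u\<bar> + S)"
  have "\<bar>u\<bar> + S \<le> P * (\<bar>u\<bar> + S)"
    using mult_right_mono[OF P1, of "\<bar>u\<bar> + S"] S0 by simp
  then have Su': "S \<le> u'" unfolding u'_def by linarith
  have "f i \<le> u' \<and> (\<exists>q\<ge>0. u' = q * d i + f i \<and> f i \<le> (of_nat i + 1) * v)" if i: "i < n" for i
  proof -
    have "d i dvd P" unfolding P_def using i by (intro dvd_prodI) auto
    moreover have "u' - f i = (u - f i) + P * (\<bar>u\<bar> + S)" by (simp add: u'_def)
    ultimately have "d i dvd u' - f i" using u[OF i] by (metis dvd_add dvd_mult2)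
    then obtain q where q: "u' - f i = d i * q" by (auto elim: dvdE)
    have "0 \<le> u' - f i" using Su' S[OF i] by simp
    then have "0 \<le> q" using q d1[of i] by (simp add: zero_le_mult_iff)
    moreover have "v \<le> (of_nat i + 1) * v"
      using mult_right_mono[of 1 "of_nat i + 1" v] v0 by simp
    ultimately show ?thesis using q S[OF i] Sv Su' by (intro conjI exI[of _ q]) (auto simp: algebra_simps)
  qed
  then show ?thesis using Su' S0 v0 unfolding d_def by (intro exI[of _ u'] exI[of _ v]) auto
qed

section \<open>The ordering of integer polynomials\<close>

lemma zero_less_poly_iff: "0 < (p :: int poly) \<longleftrightarrow> 0 < lead_coeff p"
  by (simp add: less_poly_def pos_poly_def)

lemma zero_le_poly_iff: "0 \<le> (p :: int poly) \<longleftrightarrow> 0 \<le> lead_coeff p"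
  using zero_less_poly_iff[of p] by (auto simp: order.order_iff_strict[of 0])

text \<open>A constant difference is a positive integer, hence at least 1; a nonconstant one keeps
  its leading coefficient when 1 is subtracted.\<close>

lemma int_poly_less_imp_add1_le:
  assumes "(p :: int poly) < q"
  shows "p + 1 \<le> q"
proof -
  have pos: "0 < lead_coeff (q - p)" using assms zero_less_poly_iff[of "q - p"] by (metis diff_gt_0_iff_gt)
  have "0 \<le> q - p - 1"
  proof (cases "degree (q - p) = 0")
    case True
    then obtain c where c: "q - p = [:c:]" by (metis degree_eq_zeroE)
    have "q - p - 1 = [:c - 1:]" unfolding c by (simp add: one_pCons)
    then show ?thesis using pos c by (simp add: zero_le_poly_iff)
  next
    case False
    have "degree (q - p - 1) = degree (q - p)"
      using False degree_add_eq_left[of "-1" "q - p"] by simp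
    then show ?thesis using pos False by (simp add: zero_le_poly_iff coeff_eq_0)
  qed
  then show ?thesis by (simp add: algebra_simps)
qed

lemma coeff_nonneg_of_degree_le: "0 \<le> (p :: int poly) \<Longrightarrow> degree p \<le> n \<Longrightarrow> 0 \<le> coeff p n"
  by (cases "degree p = n") (auto simp: zero_le_poly_iff coeff_eq_0)

lemma degree_mono_nonneg:
  assumes "0 \<le> p" "(p :: int poly) \<le> q"
  shows "degree p \<le> degree q"
proof (rule ccontr)
  assume "\<not> ?thesis"
  then have d: "degree q < degree p" by simp
  then have "degree (q - p) \<le> degree p" by (intro degree_diff_le) auto
  then have "0 \<le> coeff (q - p) (degree p)"
    using assms by (intro coeff_nonneg_of_degree_le) auto
  then have "lead_coeff p \<le> 0" using d by (simp add: coeff_eq_0)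
  then have "lead_coeff p = 0" using assms by (simp add: zero_le_poly_iff)
  then show False using d by simp
qed

lemma int_poly_degree_0:
  assumes "0 \<le> (p :: int poly)" "degree p = 0"
  shows "\<exists>n. p = of_nat n"
proof -
  obtain c where c: "p = [:c:]" using assms(2) by (metis degree_eq_zeroE)
  then have "p = of_nat (nat c)" using assms(1) by (simp add: zero_le_poly_iff of_nat_poly)
  then show ?thesis by blast
qed

text \<open>The standard numbers form an initial segment. This turns quantifiers over indices below
  a standard length into quantifiers over \<open>nat\<close>.\<close>

lemma int_poly_less_of_nat:
  assumes "0 \<le> (p :: int poly)" "p < of_nat n"
  shows "\<exists>j<n. p = of_nat j"
proof -
  have "degree p \<le> degree (of_nat n :: int poly)" using assms by (intro degree_mono_nonneg) auto
  then obtain j where "p = of_nat j" using assms int_poly_degree_0 by fastforce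
  then show ?thesis using assms(2) by auto
qed

section \<open>Arithmetic of the nonnegative polynomials\<close>

abbreviation "M \<equiv> ZX_nonneg"

lemma M_simps [simp]:
  "universe M = {p. 0 \<le> p}" "zero M = 0" "one M = 1" "add M = (+)" "mul M = (*)" "lt M = (<)"
  by (simp_all add: ZX_nonneg_def)

lemma is_interp_M: "is_interp M"
  by (simp add: is_interp_def)

lemma holds_PA_minus_M:
  assumes "p \<in> PA_minus"
  shows "holds M p"
proof -
  have 1: "\<exists>z\<ge>0. x + z = y" if "x < y" for x y :: "int poly"
    using that by (intro exI[of _ "y - x"]) auto
  have 2: "x = 1 \<or> 1 < x" if "0 < x" for x :: "int poly"
    using int_poly_less_imp_add1_le[OF that] by (auto simp: order.order_iff_strict)
  show ?thesis
    using assms unfolding PA_minus_def Let_def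
    by (elim insertE emptyE)
      (use 1 2 in \<open>simp_all add: holds_def eval_nat_numeral algebra_simps mult_strict_left_mono
        order.order_iff_strict linorder_less_linear\<close>)
qed

lemma pair_M: "pair M x y = (x + y)\<^sup>2 + x"
  by (simp add: pair_def power2_eq_square)

text \<open>The pair of \<open>x\<close> and \<open>y\<close> lies in the interval from
  \<open>(x + y)\<^sup>2\<close> up to, but excluding, \<open>(x + y + 1)\<^sup>2\<close>. By
  discreteness of the order these intervals are disjoint for different sums.\<close>

lemma pair_M_less:
  assumes "0 \<le> x" "0 \<le> y" "0 \<le> x'" "0 \<le> y'" "x + y < x' + y'"
  shows "pair M x y < pair M x' y'"
proof -
  have "x + y + 1 \<le> x' + y'" using assms(5) by (rule int_poly_less_imp_add1_le)
  then have "(x + y + 1)\<^sup>2 \<le> (x' + y')\<^sup>2" using assms by (intro power_mono) auto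
  moreover have "(x + y)\<^sup>2 + x < (x + y + 1)\<^sup>2"
    using assms by (simp add: power2_eq_square algebra_simps)
  ultimately show ?thesis unfolding pair_M using assms(3) by linarith
qed

lemma pair_M_inject:
  assumes "0 \<le> x" "0 \<le> y" "0 \<le> x'" "0 \<le> y'"
  shows "pair M x y = pair M x' y' \<longleftrightarrow> x = x' \<and> y = y'"
proof
  assume eq: "pair M x y = pair M x' y'"
  then have "x + y = x' + y'"
    using pair_M_less[of x y x' y'] pair_M_less[of x' y' x y] assms by (metis less_irrefl linorder_less_linear)
  then show "x = x' \<and> y = y'" using eq by (auto simp: pair_M)
qed simp

lemma pair_M_nonneg: "0 \<le> x \<Longrightarrow> 0 \<le> pair M x y"
  by (simp add: pair_M)

lemma le_pair_M:
  assumes "0 \<le> x" "0 \<le> y"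
  shows "x \<le> pair M x y"
  by (simp add: pair_M)

lemma beta_M_pair:
  assumes "0 \<le> u" "0 \<le> v"
  shows "beta M x i (pair M u v) \<longleftrightarrow>
    (\<exists>q\<ge>0. u = q * (1 + (i + 1) * v) + x \<and> x \<le> (i + 1) * v)"
proof -
  have "pair M u v = pair M u' v' \<longleftrightarrow> u' = u \<and> v' = v" if "0 \<le> u'" "0 \<le> v'" for u' v'
    using pair_M_inject[OF assms that] by auto
  then show ?thesis using assms
    by (auto simp: beta_def order.order_iff_strict[of x] simp del: M_simps(2))
qed

text \<open>By discreteness, different quotients differ by at least 1, which shifts the value by at
  least \<open>d\<close>, more than the remainders can make up.\<close>

lemma remainder_unique:
  fixes q q' x x' d :: "int poly"
  assumes "q * d + x = q' * d + x'" "0 \<le> x" "0 \<le> x'" "x < d" "x' < d"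
  shows "x = x'"
proof -
  have False if "q * d + x = q' * d + x'" "q < q'" "x < d" "0 \<le> x'" "0 \<le> x" for q q' x x' :: "int poly"
  proof -
    have "0 \<le> d" using that by simp
    then have "(q + 1) * d \<le> q' * d"
      using int_poly_less_imp_add1_le[OF that(2)] by (rule mult_right_mono[rotated])
    then show False using that by (simp add: algebra_simps)
  qed
  from this[of q x q' x'] this[of q' x' q x] assms have "q = q'"
    by (metis linorder_less_linear)
  then show ?thesis using assms by simp
qed

lemma beta_M_unique:
  assumes "beta M x i w" "beta M x' i w" "0 \<le> i" "0 \<le> x" "0 \<le> x'"
  shows "x = x'"
proof -
  obtain u v where uv: "0 \<le> u" "0 \<le> v" "w = pair M u v"
    using assms(1) by (auto simp: beta_def)
  obtain q where q: "u = q * (1 + (i + 1) * v) + x" "x \<le> (i + 1) * v"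
    using assms(1) uv beta_M_pair by blast
  obtain q' where q': "u = q' * (1 + (i + 1) * v) + x'" "x' \<le> (i + 1) * v"
    using assms(2) uv beta_M_pair by blast
  show ?thesis
    by (rule remainder_unique[of q "1 + (i + 1) * v" x q' x']) (use q q' assms in \<open>auto simp: add_strict_increasing2 \<close>)
qed

lemma beta_M_coding:
  assumes "\<And>i. i < n \<Longrightarrow> 0 \<le> f i"
  shows "\<exists>w\<ge>0. \<forall>i<n. beta M (f i) (of_nat i) w \<and> f i \<le> w"
proof -
  obtain u v where uv: "0 \<le> u" "0 \<le> v" "\<And>i. i < n \<Longrightarrow> f i \<le> u \<and>
    (\<exists>q\<ge>0. u = q * (1 + (of_nat i + 1) * v) + f i \<and> f i \<le> (of_nat i + 1) * v)"
    using beta_coding[of n f] assms by metis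
  then show ?thesis
    using le_pair_M[of u v] pair_M_nonneg[of u v]
    by (intro exI[of _ "pair M u v"]) (auto simp: beta_M_pair intro: order_trans)
qed

section \<open>Unique factorisation\<close>

lemma has_length_M_unique:
  "has_length M s n \<Longrightarrow> has_length M s n' \<Longrightarrow> 0 \<le> n \<Longrightarrow> 0 \<le> n' \<Longrightarrow> n = n'"
  by (auto simp: has_length_def seq_rep_def pair_M_inject)

lemma has_elem_M_unique:
  "has_elem M s i x \<Longrightarrow> has_elem M s i x' \<Longrightarrow> 0 \<le> i \<Longrightarrow> 0 \<le> x \<Longrightarrow> 0 \<le> x' \<Longrightarrow> x = x'"
  by (auto simp: has_elem_def seq_rep_def pair_M_inject intro: beta_M_unique)

lemma has_elem_M_less_length:
  "has_elem M s i x \<Longrightarrow> has_length M s n \<Longrightarrow> 0 \<le> n \<Longrightarrow> i < n"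
  by (auto simp: has_elem_def has_length_def seq_rep_def pair_M_inject)

lemma has_length_M_imp_has_elem:
  assumes "has_length M s n" "0 \<le> n" "0 \<le> i" "i < n"
  shows "\<exists>x\<ge>0. has_elem M s i x"
proof -
  obtain w where w: "w \<in> universe M" "seq_rep M s n w"
    using assms(1) unfolding has_length_def by blast
  then obtain x where x: "x \<in> universe M" "beta M x i w"
    using assms unfolding seq_rep_def by auto
  have "has_elem M s i x"
    unfolding has_elem_def using assms w x by (rule_tac bexI[of _ n], rule_tac bexI[of _ w]) auto
  then show ?thesis using x(1) by auto
qed

lemma pseq_M_prime: "pseq M s \<Longrightarrow> has_elem M s i x \<Longrightarrow> 0 \<le> i \<Longrightarrow> 0 \<le> x \<Longrightarrow> is_prime M x"
  by (simp add: pseq_def)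

lemma pseq_M_le:
  assumes "pseq M s" "has_elem M s i x" "has_elem M s j y" "0 \<le> i" "i < j" "0 \<le> x" "0 \<le> y"
  shows "x \<le> y"
proof -
  have "lt M x y \<or> x = y" if "i \<in> universe M" "j \<in> universe M" "x \<in> universe M" "y \<in> universe M"
    "lt M i j"
    using assms(1-3) that unfolding pseq_def by blast
  then show ?thesis using assms by auto
qed

lemma seq_coding_M:
  assumes f: "\<And>i. i < n \<Longrightarrow> 0 \<le> f i"
  shows "\<exists>s\<ge>0. has_length M s (of_nat n) \<and> (\<forall>i<n. has_elem M s (of_nat i) (f i))"
proof -
  obtain w where w: "0 \<le> w" "\<And>i. i < n \<Longrightarrow> beta M (f i) (of_nat i) w \<and> f i \<le> w"
    using beta_M_coding[of n f] f by blast
  have "seq_rep M (pair M (of_nat n) w) (of_nat n) w"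
    unfolding seq_rep_def
  proof (intro conjI ballI impI)
    fix i assume "i \<in> universe M" "lt M i (of_nat n)"
    then obtain j where "j < n" "i = of_nat j" using int_poly_less_of_nat by auto
    then show "\<exists>x\<in>universe M. (lt M x w \<or> x = w) \<and> beta M x i w"
      using w(2)[of j] f[of j] by (intro bexI[of _ "f j"]) (auto simp: order.order_iff_strict)
  qed simp
  then have *: "\<exists>w'\<in>universe M. seq_rep M (pair M (of_nat n) w) (of_nat n) w' \<and> w' = w"
    using w(1) by simp
  have "has_length M (pair M (of_nat n) w) (of_nat n)"
    unfolding has_length_def using * by blast
  moreover have "has_elem M (pair M (of_nat n) w) (of_nat i) (f i)" if "i < n" for i
    unfolding has_elem_def using * w(2)[OF that] that by (rule_tac bexI[of _ "of_nat n :: int poly"]) auto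
  ultimately show ?thesis
    using w(1) by (intro exI[of _ "pair M (of_nat n) w"]) (auto simp: pair_M_nonneg)
qed

section \<open>Divisibility and primes among the nonnegative polynomials\<close>

lemma divides_M:
  assumes "0 \<le> a" "0 \<le> b"
  shows "divides M a b \<longleftrightarrow> a dvd b"
proof
  assume "a dvd b"
  then obtain c where c: "b = a * c" by (auto elim: dvdE)
  then have "a * \<bar>c\<bar> = b" using assms by (metis abs_mult abs_of_nonneg)
  then show "divides M a b" unfolding divides_def by (intro bexI[of _ "\<bar>c\<bar>"]) auto
qed (auto simp: divides_def)

text \<open>The units of Z[X] are 1 and -1, so normalising only fixes the sign. Hence the normalised
  primes of the library are the nonnegative prime elements.\<close>

lemma normalize_int_poly: "normalize (p :: int poly) = \<bar>p\<bar>"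
proof -
  have *: "normalize p = p" if "0 \<le> p" for p :: "int poly"
  proof (cases "p = 0")
    case False
    then have "unit_factor (lead_coeff p) = 1" using that zero_less_poly_iff[of p] by simp
    then show ?thesis by (simp add: normalize_poly_eq_map_poly)
  qed auto
  show ?thesis
  proof (cases "0 \<le> p")
    case False
    then have "normalize (- p) = - p" by (intro *) simp
    then show ?thesis using False by simp
  qed (simp add: *)
qed

lemma is_prime_M:
  assumes "0 \<le> p"
  shows "is_prime M p \<longleftrightarrow> prime p"
proof
  assume p: "is_prime M p"
  have "p dvd a \<or> p dvd b" if "p dvd a * b" for a b
  proof -
    have "divides M p (\<bar>a\<bar> * \<bar>b\<bar>)" using that assms by (simp add: divides_M flip: abs_mult)
    then have "divides M p \<bar>a\<bar> \<or> divides M p \<bar>b\<bar>" using p by (auto simp: is_prime_def)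
    then show ?thesis using assms by (simp add: divides_M)
  qed
  moreover have "\<not> p dvd 1"
  proof
    assume "p dvd 1"
    then have "normalize p = 1" by (simp add: is_unit_normalize)
    then show False using p assms by (simp add: normalize_int_poly is_prime_def)
  qed
  ultimately have "prime_elem p" using p by (intro prime_elemI) (auto simp: is_prime_def)
  then show "prime p" using assms by (simp add: prime_def normalize_int_poly)
next
  assume p: "prime p"
  have "p \<noteq> 0" "p \<noteq> 1" using p by auto
  then have "1 < p" using int_poly_less_imp_add1_le[of 0 p] assms by auto
  moreover have "divides M p a \<or> divides M p b" if "divides M p (a * b)" "0 \<le> a" "0 \<le> b" for a b
    using that p assms by (simp add: divides_M prime_dvd_mult_iff)
  ultimately show "is_prime M p" by (auto simp: is_prime_def)
qed

text \<open>If all quotients are positive, then \<open>u\<close> exceeds every standard multiple of \<open>v\<close>. A standard \<open>v\<close> is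
  ruled out by the exponential growth of the remainders; for the others the leading coefficient
  of \<open>u\<close> is divisible by all positive integers.\<close>

lemma no_growing_remainders:
  fixes u v :: "int poly"
  assumes "0 \<le> u" "0 \<le> v"
    and q: "\<And>j. 0 \<le> q j"
    and u: "\<And>j. u = q j * (1 + (of_nat j + 1) * v) + y j"
    and y: "\<And>j. 2 ^ j \<le> y j" "\<And>j. y j \<le> (of_nat j + 1) * v" "\<And>j. y j < y (Suc j)"
  shows False
proof -
  have y0: "0 \<le> y j" for j using y(1)[of j] by (rule order_trans[rotated]) simp
  have d0: "0 \<le> 1 + (of_nat j + 1) * v" for j using \<open>0 \<le> v\<close> by simp
  \<comment> \<open>A zero quotient at \<open>j\<close> would give \<open>u = y j\<close>, but
    \<open>y j < y (Suc j)\<close> and every remainder is at most \<open>u\<close>.\<close>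
  have qpos: "1 \<le> q j" for j
  proof (rule ccontr)
    assume "\<not> ?thesis"
    then have "q j = 0" using q[of j] int_poly_less_imp_add1_le[of 0 "q j"] by force
    then have "u = y j" using u[of j] by simp
    moreover have "y (Suc j) \<le> u"
      using q[of "Suc j"] d0[of "Suc j"] by (subst u[of "Suc j"]) simp
    ultimately show False using y(3)[of j] by simp
  qed
  have uv: "of_nat j * v \<le> u" for j
  proof -
    have "of_nat j * v \<le> 1 * (1 + (of_nat j + 1) * v)" using \<open>0 \<le> v\<close> by (simp add: algebra_simps)
    also have "\<dots> \<le> q j * (1 + (of_nat j + 1) * v)" using qpos d0 by (rule mult_right_mono)
    also have "\<dots> \<le> u" using y0[of j] by (subst u[of j]) simp
    finally show ?thesis .
  qed
  have v0: "v \<noteq> 0"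
    using y(1)[of 0] y(2)[of 0] by auto
  have dv: "degree v \<noteq> 0"
  proof
    assume "degree v = 0"
    then obtain V where V: "v = of_nat V" using int_poly_degree_0 \<open>0 \<le> v\<close> by blast
    have "2 ^ j \<le> (j + 1) * V" for j
    proof -
      have "(of_nat (2 ^ j) :: int poly) \<le> of_nat ((j + 1) * V)"
        using order_trans[OF y(1)[of j] y(2)[of j]] V by (simp add: algebra_simps)
      then show ?thesis by (simp only: of_nat_le_iff)
    qed
    \<comment> \<open>At this exponent the left side is at least \<open>16 * (V * V)\<close>, while
      the right side is \<open>2 * (V * V) + 5 * V\<close>, at most
      \<open>7 * (V * V)\<close>.\<close>
    from this[of "2 * V + 4"] have *: "2 ^ (2 * V + 4) \<le> (2 * V + 5) * V" by (simp add: add.commute)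
    have "V < 2 ^ V" by (rule less_exp)
    then have "V * V \<le> 2 ^ V * 2 ^ V" by (intro mult_le_mono) auto
    moreover have "2 ^ (2 * V + 4) = 16 * (2 ^ V * 2 ^ V :: nat)"
      unfolding power_add mult_2 by simp
    ultimately have "16 * (V * V) \<le> 2 ^ (2 * V + 4)" by linarith
    moreover have "V \<le> V * V" by simp
    moreover have "0 < V" using v0 V by auto
    moreover have "(2 * V + 5) * V = 2 * (V * V) + 5 * V" by (simp add: algebra_simps)
    ultimately show False using * by linarith
  qed
  have lv: "0 < lead_coeff v" using v0 \<open>0 \<le> v\<close> zero_less_poly_iff[of v] by auto
  have du: "degree v < degree u"
  proof (rule ccontr)
    assume "\<not> ?thesis"
    then have le: "degree u \<le> degree v" by simp
    \<comment> \<open>Chosen to exceed the coefficient of \<open>u\<close> at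
      \<open>degree v\<close>: if \<open>u\<close> had no larger degree, \<open>j\<close> copies of
      \<open>v\<close> could not fit below it.\<close>
    define j where "j = nat (coeff u (degree v)) + 1"
    have "0 \<le> u - smult (int j) v" using uv[of j] by (simp add: of_nat_poly)
    moreover have "degree (u - smult (int j) v) \<le> degree v"
      using le by (intro degree_diff_le) (auto intro: degree_smult_le[THEN order_trans])
    ultimately have "0 \<le> coeff (u - smult (int j) v) (degree v)"
      by (rule coeff_nonneg_of_degree_le)
    then have "int j * lead_coeff v \<le> coeff u (degree v)" by simp
    moreover have "int j * 1 \<le> int j * lead_coeff v" using lv by (intro mult_left_mono) auto
    moreover have "coeff u (degree v) < int j" by (simp add: j_def)
    ultimately show False by linarith
  qed
  \<comment> \<open>The remainder has degree at most that of \<open>v\<close>, hence below that of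
    \<open>u\<close>. So the leading coefficient of \<open>u\<close> comes from quotient times
    modulus, and that of the modulus is \<open>Suc j\<close> times that of \<open>v\<close>, as
    \<open>v\<close> is not constant.\<close>
  have dvd: "int (Suc j) dvd lead_coeff u" for j
  proof -
    have deg1: "degree ((of_nat j + 1) * v) = degree v"
      using degree_mult_eq[of "of_nat (Suc j)" v] v0 by (simp add: add.commute del: of_nat_Suc) (simp add: add.commute)
    have "degree (y j) \<le> degree v" using degree_mono_nonneg[OF y0 y(2)[of j]] deg1 by simp
    then have cu: "lead_coeff u = coeff (q j * (1 + (of_nat j + 1) * v)) (degree u)"
      using du by (subst (1) u[of j]) (simp add: coeff_eq_0)
    moreover have "degree (q j * (1 + (of_nat j + 1) * v)) = degree u"
    proof -
      have "degree (q j * (1 + (of_nat j + 1) * v)) = degree (u - y j)" by (subst u[of j]) simp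
      also have "\<dots> \<le> degree u" using \<open>degree (y j) \<le> degree v\<close> du by (intro degree_diff_le) auto
      finally have "degree (q j * (1 + (of_nat j + 1) * v)) \<le> degree u" .
      moreover have "lead_coeff u \<noteq> 0" using du by auto
      ultimately show ?thesis using cu by (metis le_degree le_antisym)
    qed
    ultimately have "lead_coeff u = lead_coeff (q j) * lead_coeff (1 + (of_nat j + 1) * v)"
      by (metis lead_coeff_mult)
    also have "lead_coeff (1 + (of_nat j + 1) * v) = lead_coeff ((of_nat j + 1) * v)"
      using deg1 dv by (intro lead_coeff_add_le) simp
    also have "\<dots> = int (Suc j) * lead_coeff v"
      by (simp add: lead_coeff_mult of_nat_poly one_pCons)
    finally show ?thesis by simp
  qed
  have "lead_coeff u \<noteq> 0" using du by auto
  \<comment> \<open>A nonzero integer is not divisible by its absolute value plus 1.\<close>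
  then have "int (Suc (nat \<bar>lead_coeff u\<bar>)) \<le> \<bar>lead_coeff u\<bar>"
    using dvd[of "nat \<bar>lead_coeff u\<bar>"] by (metis dvd_imp_le_int abs_of_nat)
  then show False by simp
qed

text \<open>The witness \<open>t\<close> of the product holds the partial products at all standard
  indices up to the length. If the length were nonstandard, these would be infinitely many
  remainders growing at least like powers of 2, as primes are at least 2, against
  \<open>no_growing_remainders\<close>.\<close>

lemma has_prod_M_standard_length:
  assumes s: "pseq M s" "has_prod M s x" "0 \<le> x"
  shows "\<exists>n f. has_length M s (of_nat n) \<and>
    (\<forall>i<n. 0 \<le> f i \<and> has_elem M s (of_nat i) (f i)) \<and> x = (\<Prod>i<n. f i)"
proof -
  obtain n t where n: "0 \<le> n" "0 \<le> t" "has_length M s n" "has_length M t (n + 1)"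
    "has_elem M t 0 1" "has_elem M t n x"
    and *: "\<forall>i\<in>universe M. lt M i n \<longrightarrow> (\<exists>y\<in>universe M. \<exists>z\<in>universe M.
      has_elem M t i y \<and> has_elem M s i z \<and> has_elem M t (i + 1) (y * z))"
    using s(2) unfolding has_prod_def by auto
  have step: "\<exists>y\<ge>0. \<exists>z\<ge>0. has_elem M t i y \<and> has_elem M s i z \<and>
      has_elem M t (i + 1) (y * z)" if i: "0 \<le> i" "i < n" for i
  proof -
    obtain y z where "0 \<le> y" "0 \<le> z" "has_elem M t i y \<and> has_elem M s i z \<and> has_elem M t (i + 1) (y * z)"
      using * i unfolding M_simps by blast
    then show ?thesis by blast
  qed
  define f where "f i = (SOME z. 0 \<le> z \<and> has_elem M s (of_nat i) z)" for i
  have f: "0 \<le> f i \<and> has_elem M s (of_nat i) (f i)" if "of_nat i < n" for i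
  proof -
    have "\<exists>z. 0 \<le> z \<and> has_elem M s (of_nat i) z"
      using has_length_M_imp_has_elem[of s n "of_nat i"] n that by auto
    then show ?thesis unfolding f_def by (rule someI_ex)
  qed
  define y where "y m = (\<Prod>i<m. f i)" for m
  have ypos: "0 \<le> y m" if "of_nat m \<le> n" for m
    unfolding y_def
  proof (rule prod_nonneg)
    fix i assume "i \<in> {..<m}"
    then have "of_nat i < (of_nat m :: int poly)" by simp
    then have "of_nat i < n" using that by (rule less_le_trans)
    then show "0 \<le> f i" using f by blast
  qed
  \<comment> \<open>The induction runs over standard indices only; \<open>n\<close> itself may still
    be nonstandard here.\<close>
  have t: "has_elem M t (of_nat m) (y m)" if "of_nat m \<le> n" for m
    using that
  proof (induction m)
    case (Suc m)
    have m: "of_nat m < n"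
      by (rule less_le_trans[OF _ Suc.prems]) simp
    obtain a b where ab: "0 \<le> a" "0 \<le> b" "has_elem M t (of_nat m) a" "has_elem M s (of_nat m) b"
      "has_elem M t (of_nat m + 1) (a * b)"
      using step[of "of_nat m"] m by (auto simp del: of_nat_Suc)
    have "b = f m" using f[OF m] ab has_elem_M_unique[of s "of_nat m" b "f m"] by simp
    moreover have "a = y m"
      using Suc.IH m ab ypos[of m] has_elem_M_unique[of t "of_nat m" a "y m"] by simp
    ultimately show ?case using ab by (simp add: y_def add.commute)
  qed (use n in \<open>simp add: y_def\<close>)
  show ?thesis
  proof (cases "\<exists>k. n < of_nat k")
    case True
    then obtain k where k: "n = of_nat k" using int_poly_less_of_nat n(1) by blast
    then have "x = y k" using t[of k] n has_elem_M_unique[of t n x "y k"] s(3) ypos[of k] by simp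
    then show ?thesis using n(3) f k unfolding y_def by (intro exI[of _ k] exI[of _ f]) auto
  next
    case False
    then have le: "of_nat k \<le> n" and less: "of_nat k < n" for k
      by (auto simp: not_less) (metis le_less_linear of_nat_less_iff lessI order.strict_trans2)
    have prime: "2 \<le> f i" for i
    proof -
      have "is_prime M (f i)" using pseq_M_prime[of s "of_nat i" "f i"] s(1) f[OF less[of i]] by simp
      then show ?thesis using int_poly_less_imp_add1_le[of 1 "f i"] by (simp add: is_prime_def)
    qed
    have ge: "2 ^ m \<le> y m" for m
    proof -
      have "(\<Prod>i<m. 2) \<le> y m" unfolding y_def using prime by (intro prod_mono) auto
      then show ?thesis by simp
    qed
    have grow: "y m < y (Suc m)" for m
    proof -
      have "0 < y m" using ge[of m] by (rule order.strict_trans2[rotated]) simp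
      then have "y m * 1 < y m * f m" using prime[of m]
        by (intro mult_strict_left_mono) (auto intro: order.strict_trans2[of 1 2])
      then show ?thesis by (simp add: y_def)
    qed
    obtain w where w: "0 \<le> w" "t = pair M (n + 1) w"
      using n(4) by (auto simp: has_length_def seq_rep_def)
    have b: "beta M (y j) (of_nat j) w" for j
      using t[OF le[of j]] w n(1) by (auto simp: has_elem_def seq_rep_def pair_M_inject)
    obtain u v where uv: "0 \<le> u" "0 \<le> v" "w = pair M u v"
      using b[of 0] by (auto simp: beta_def)
    have "\<exists>q\<ge>0. u = q * (1 + (of_nat j + 1) * v) + y j \<and> y j \<le> (of_nat j + 1) * v" for j
      using b[of j] uv beta_M_pair[of u v "y j" "of_nat j"] by simp
    then obtain q where "\<And>j. 0 \<le> q j \<and> u = q j * (1 + (of_nat j + 1) * v) + y j \<and> y j \<le> (of_nat j + 1) * v"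
      by metis
    then have False using no_growing_remainders[of u v q y] uv ge grow by blast
    then show ?thesis ..
  qed
qed

lemma has_prod_M:
  assumes "0 \<le> s" "has_length M s (of_nat n)"
    and f: "\<And>i. i < n \<Longrightarrow> 0 \<le> f i \<and> has_elem M s (of_nat i) (f i)"
  shows "has_prod M s (\<Prod>i<n. f i)"
proof -
  define y where "y m = (\<Prod>i<m. f i)" for m
  have y: "0 \<le> y m" if "m \<le> n" for m
    unfolding y_def using that f by (intro prod_nonneg) auto
  obtain t where t: "0 \<le> t" "has_length M t (of_nat (Suc n))" "\<And>i. i < Suc n \<Longrightarrow> has_elem M t (of_nat i) (y i)"
    using seq_coding_M[of "Suc n" y] y by auto
  have "\<exists>a\<ge>0. \<exists>b\<ge>0. has_elem M t i a \<and> has_elem M s i b \<and> has_elem M t (i + 1) (a * b)"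
    if i: "0 \<le> i" "i < of_nat n" for i
  proof -
    obtain j where j: "j < n" "i = of_nat j" using int_poly_less_of_nat[OF i] by blast
    show ?thesis using t(3)[of j] t(3)[of "Suc j"] f[of j] j y[of j]
      by (intro exI[of _ "y j"] exI[of _ "f j"] conjI) (auto simp: y_def add.commute)
  qed
  then have "\<forall>i\<in>universe M. lt M i (of_nat n) \<longrightarrow> (\<exists>a\<in>universe M. \<exists>b\<in>universe M.
      has_elem M t i a \<and> has_elem M s i b \<and> has_elem M t (add M i (one M)) (mul M a b))"
    unfolding M_simps by blast
  then show ?thesis
    unfolding has_prod_def using assms t(1,2) t(3)[of 0] t(3)[of n]
    by (intro bexI[of _ "of_nat n"] bexI[of _ t]) (auto simp: y_def add.commute)
qed

text \<open>Replaces an internal sequence of standard length by a list, so that sorted lists of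
  primes can be compared with multisets.\<close>

lemma pseq_M:
  assumes len: "has_length M s (of_nat n)"
    and f: "\<And>i. i < n \<Longrightarrow> 0 \<le> f i \<and> has_elem M s (of_nat i) (f i)"
  shows "pseq M s \<longleftrightarrow> sorted (map f [0..<n]) \<and> (\<forall>p\<in>set (map f [0..<n]). prime p)"
proof -
  have el: "has_elem M s i x \<longleftrightarrow> (\<exists>j<n. i = of_nat j \<and> x = f j)" if ix: "0 \<le> i" "0 \<le> x" for i x
  proof
    assume "has_elem M s i x"
    moreover from this have "i < of_nat n" using len by (intro has_elem_M_less_length) auto
    then obtain j where "j < n" "i = of_nat j" using int_poly_less_of_nat ix(1) by blast
    ultimately show "\<exists>j<n. i = of_nat j \<and> x = f j"
      using f[of j] has_elem_M_unique[of s i x "f j"] ix by auto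
  qed (use f in auto)
  have seq: "is_seq M s" using len unfolding is_seq_def has_length_def by (rule_tac bexI[of _ "of_nat n"]) auto
  have "pseq M s \<longleftrightarrow> (\<forall>i<n. is_prime M (f i)) \<and> (\<forall>i j. i < j \<and> j < n \<longrightarrow> f i \<le> f j)"
  proof
    assume L: "pseq M s"
    then have "is_prime M (f i)" if "i < n" for i
      using f[OF that] pseq_M_prime[of s "of_nat i" "f i"] by simp
    moreover have "f i \<le> f j" if "i < j" "j < n" for i j
    proof -
      have "i < n" using that by simp
      then have "has_elem M s (of_nat i) (f i)" "has_elem M s (of_nat j) (f j)" "0 \<le> f i" "0 \<le> f j"
        using f that by auto
      then show ?thesis using pseq_M_le[OF L, of "of_nat i" "f i" "of_nat j" "f j"] that by simp
    qed
    ultimately show "(\<forall>i<n. is_prime M (f i)) \<and> (\<forall>i j. i < j \<and> j < n \<longrightarrow> f i \<le> f j)" by blast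
  next
    assume "(\<forall>i<n. is_prime M (f i)) \<and> (\<forall>i j. i < j \<and> j < n \<longrightarrow> f i \<le> f j)"
    then show "pseq M s" using seq by (auto simp: pseq_def el simp flip: order.order_iff_strict)
  qed
  then show ?thesis
    using f by (auto simp: is_prime_M sorted_iff_nth_mono_less)
qed

lemma approx_M:
  assumes "has_length M s (of_nat n)" "\<And>i. i < n \<Longrightarrow> 0 \<le> f i \<and> has_elem M s (of_nat i) (f i)"
  shows "approx M s s' \<longleftrightarrow> has_length M s' (of_nat n) \<and> (\<forall>i<n. has_elem M s' (of_nat i) (f i))"
proof
  assume "approx M s s'"
  then obtain m where m: "0 \<le> m" "has_length M s m" "has_length M s' m"
    "\<And>i. 0 \<le> i \<Longrightarrow> i < m \<Longrightarrow> \<exists>x\<ge>0. has_elem M s i x \<and> has_elem M s' i x"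
    by (auto simp: approx_def)
  have mn: "m = of_nat n" using has_length_M_unique m assms(1) by auto
  have "has_elem M s' (of_nat i) (f i)" if i: "i < n" for i
  proof -
    obtain x where "0 \<le> x" "has_elem M s (of_nat i) x" "has_elem M s' (of_nat i) x"
      using m(4)[of "of_nat i"] mn i by auto
    then show ?thesis using assms(2)[OF i] has_elem_M_unique[of s "of_nat i" x "f i"] by simp
  qed
  then show "has_length M s' (of_nat n) \<and> (\<forall>i<n. has_elem M s' (of_nat i) (f i))"
    using m mn by simp
next
  assume R: "has_length M s' (of_nat n) \<and> (\<forall>i<n. has_elem M s' (of_nat i) (f i))"
  have "\<exists>x\<ge>0. has_elem M s i x \<and> has_elem M s' i x" if "0 \<le> i" "i < of_nat n" for i
    using int_poly_less_of_nat[OF that] assms(2) R by blast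
  then show "approx M s s'" using R assms(1)
    unfolding approx_def by (intro bexI[of _ "of_nat n"]) auto
qed

text \<open>The witness codes the sorted list of prime factors of \<open>x\<close>. Any competing
  sequence has standard length and gives a sorted list with the same multiset of entries, hence the
  same list.\<close>

lemma holds_UF_M: "holds M UF"
  unfolding holds_def sat_UF
proof (intro allI impI ballI)
  fix x assume "x \<in> universe M" "lt M (zero M) x"
  then have x: "0 < x" by simp
  define ps where "ps = sorted_list_of_multiset (prime_factorization x)"
  define n where "n = length ps"
  define f where "f i = ps ! i" for i
  have ps: "map f [0..<n] = ps" unfolding f_def n_def by (rule map_nth)
  have primes: "prime p" if "p \<in> set ps" for p
    using that by (auto simp: ps_def)
  have pos: "0 \<le> p" if "prime p" for p :: "int poly"
    using that by (metis normalize_prime normalize_int_poly abs_ge_zero)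
  have f: "0 \<le> f i" if "i < n" for i
    using that primes pos by (simp add: f_def n_def)
  have prod: "(\<Prod>i<n. g i) = prod_list (map g [0..<n])" for g :: "nat \<Rightarrow> int poly" and n
    by (simp add: prod.list_conv_set_nth atLeast0LessThan)
  have psx: "prod_list ps = x"
  proof -
    \<comment> \<open>The factorisation recovers \<open>x\<close> up to a unit only; as both sides
      are nonnegative, they agree.\<close>
    have "normalize (prod_mset (mset ps)) = normalize x"
      unfolding ps_def using x prod_mset_prime_factorization_weak[of x] by simp
    moreover have "0 \<le> prod_list (map f [0..<n])" unfolding prod[symmetric] using f by (intro prod_nonneg) auto
    ultimately show ?thesis using x ps by (simp add: normalize_int_poly prod_mset_prod_list)
  qed
  obtain s where s: "0 \<le> s" "has_length M s (of_nat n)" "\<And>i. i < n \<Longrightarrow> 0 \<le> f i \<and> has_elem M s (of_nat i) (f i)"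
    using seq_coding_M[of n f] f by auto
  have "pseq M s" using pseq_M[OF s(2,3)] primes by (simp add: ps) (simp add: ps_def)
  moreover have apx: "approx M s s' \<longleftrightarrow> has_length M s' (of_nat n) \<and> (\<forall>i<n. has_elem M s' (of_nat i) (f i))"
    for s' using approx_M[of s n f s'] s(2,3) by blast
  have "has_prod M s' x \<longleftrightarrow> approx M s s'" if s': "0 \<le> s'" "pseq M s'" for s'
    unfolding apx
  proof
    assume "has_prod M s' x"
    then obtain m g where g: "has_length M s' (of_nat m)"
      "\<And>i. i < m \<Longrightarrow> 0 \<le> g i \<and> has_elem M s' (of_nat i) (g i)" "x = (\<Prod>i<m. g i)"
      using has_prod_M_standard_length[of s' x] s' x by auto
    define qs where "qs = map g [0..<m]"
    have qs: "sorted qs" "\<And>p. p \<in> set qs \<Longrightarrow> prime p"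
      using s'(2) pseq_M[of s' m g] g(1,2) unfolding qs_def by blast+
    have "x = prod_mset (mset qs)"
      using g(3) prod[where g = g and n = m] unfolding qs_def prod_mset_prod_list by simp
    then have "prime_factorization x = mset qs"
      using qs(2) prime_factorization_prod_mset_primes[of "mset qs"] by simp
    then have "ps = qs" using qs(1) by (simp add: ps_def sorted_sort_id)
    then have eq: "map f [0..<n] = map g [0..<m]" by (simp add: ps qs_def)
    then have "n = m" by (metis length_map length_upt diff_zero)
    moreover from this eq have "\<And>i. i < n \<Longrightarrow> f i = g i" by (simp add: map_eq_conv)
    ultimately show "has_length M s' (of_nat n) \<and> (\<forall>i<n. has_elem M s' (of_nat i) (f i))"
      using g by simp
  next
    assume "has_length M s' (of_nat n) \<and> (\<forall>i<n. has_elem M s' (of_nat i) (f i))"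
    then have "has_prod M s' (\<Prod>i<n. f i)" using s'(1) f by (intro has_prod_M) auto
    then show "has_prod M s' x" by (simp add: prod ps psx)
  qed
  ultimately show "\<exists>s\<in>universe M. pseq M s \<and>
      (\<forall>s'\<in>universe M. pseq M s' \<longrightarrow> (has_prod M s' x \<longleftrightarrow> approx M s s'))"
    using s(1) by auto
qed

section \<open>Translating the structure into a definable cut\<close>

text \<open>Squaring excludes the elements \<open>X - k\<close>, so that for \<open>x = X\<close> the cut consists of the natural
  numbers.\<close>

definition cut :: "'a interp \<Rightarrow> 'a \<Rightarrow> 'a set" where
  "cut A x = {a \<in> universe A. lt A a x \<and> lt A (mul A a a) x}"

definition AllN :: "tm \<Rightarrow> fm \<Rightarrow> fm" where
  "AllN x p = AllLt x (Imp (Lt (Mul (Var 0) (Var 0)) (shift 1 x)) p)"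

definition ExN :: "tm \<Rightarrow> fm \<Rightarrow> fm" where
  "ExN x p = ExLt x (And (Lt (Mul (Var 0) (Var 0)) (shift 1 x)) p)"

lemma sat_AllN [simp]: "sat A e (AllN x p) \<longleftrightarrow> (\<forall>a\<in>cut A (eval A e x). sat A (case_nat a e) p)"
  by (auto simp: AllN_def cut_def)

lemma sat_ExN [simp]: "sat A e (ExN x p) \<longleftrightarrow> (\<exists>a\<in>cut A (eval A e x). sat A (case_nat a e) p)"
  by (auto simp: ExN_def cut_def)

text \<open>The cut contains 2 and is closed under squaring. Iterated squares of 2 make it reach
  every natural number, and iterated squares of its other elements would grow too fast.\<close>

definition theta_fm :: "tm \<Rightarrow> fm" where
  "theta_fm x = And (And (Lt (Add One One) x) (Lt (Mul (Add One One) (Add One One)) x))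
     (AllN x (let y = Mul (Var 0) (Var 0) in And (Lt y (shift 1 x)) (Lt (Mul y y) (shift 1 x))))"

text \<open>This is the remainder condition of \<open>beta_fm\<close> with the quotient confined to
  the cut, which keeps it Delta_0.\<close>

definition rem_fm :: "tm \<Rightarrow> tm \<Rightarrow> tm \<Rightarrow> tm \<Rightarrow> tm \<Rightarrow> fm" where
  "rem_fm x r i u v =
    ExN x (let q = Var 0; r = shift 1 r; d = Mul (Add (shift 1 i) One) (shift 1 v) in
      And (Eq (shift 1 u) (Add (Mul q (Add One d)) r)) (Le r d))"

text \<open>A polynomial is coded by its number \<open>n\<close> of coefficients and numbers \<open>u\<close>, \<open>v\<close>, \<open>g\<close>: the coefficients,
  leading one first, are the remainders \<open>a\<close> of \<open>u\<close> minus \<open>g\<close>. The pair \<open>u'\<close>, \<open>v'\<close> codes the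
  partial results of Horner's scheme at \<open>k\<close>, the last one being \<open>m\<close>.\<close>

definition horner_fm :: "tm \<Rightarrow> tm \<Rightarrow> tm \<Rightarrow> tm \<Rightarrow> fm" where
  "horner_fm x c k m =
    ExN x (ExN (shift 1 x) (ExN (shift 2 x) (ExN (shift 3 x) (ExN (shift 4 x) (ExN (shift 5 x)
      (let n = Var 5; u = Var 4; v = Var 3; g = Var 2; u' = Var 1; v' = Var 0;
           x = shift 6 x; c = shift 6 c; m = shift 6 m in
       And (Eq c (pair_tm n (pair_tm u (pair_tm v g))))
      (And (rem_fm x Zero Zero u' v')
      (And (rem_fm x m n u' v')
           (AllN x (Imp (Lt (Var 0) (Var 6))
             (ExN (shift 1 x) (ExN (shift 2 x) (ExN (shift 3 x)
               (let i = Var 3; a = Var 2; t = Var 1; t' = Var 0;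
                    u = Var 8; v = Var 7; g = Var 6; u' = Var 5; v' = Var 4;
                    x = shift 3 (shift 1 x); k = shift 10 k in
                And (rem_fm x a i u v)
               (And (rem_fm x t i u' v')
               (And (rem_fm x t' (Add i One) u' v')
                    (Eq (Add t' g) (Add (Mul k t) a))))))))))))))))))"

definition cut_rem :: "'a interp \<Rightarrow> 'a set \<Rightarrow> 'a \<Rightarrow> 'a \<Rightarrow> 'a \<Rightarrow> 'a \<Rightarrow> bool" where
  "cut_rem A N r i u v \<longleftrightarrow> (\<exists>q\<in>N. let d = mul A (add A i (one A)) v in
     u = add A (mul A q (add A (one A) d)) r \<and> (lt A r d \<or> r = d))"

definition horner :: "'a interp \<Rightarrow> 'a set \<Rightarrow> 'a \<Rightarrow> 'a \<Rightarrow> 'a \<Rightarrow> bool" where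
  "horner A N c k m \<longleftrightarrow> (\<exists>n\<in>N. \<exists>u\<in>N. \<exists>v\<in>N. \<exists>g\<in>N. \<exists>u'\<in>N. \<exists>v'\<in>N.
     c = pair A n (pair A u (pair A v g)) \<and>
     cut_rem A N (zero A) (zero A) u' v' \<and> cut_rem A N m n u' v' \<and>
     (\<forall>i\<in>N. lt A i n \<longrightarrow> (\<exists>a\<in>N. \<exists>t\<in>N. \<exists>t'\<in>N.
        cut_rem A N a i u v \<and> cut_rem A N t i u' v' \<and> cut_rem A N t' (add A i (one A)) u' v' \<and>
        add A t' g = add A (mul A k t) a)))"

definition theta :: "'a interp \<Rightarrow> 'a \<Rightarrow> bool" where
  "theta A x \<longleftrightarrow> lt A (add A (one A) (one A)) x \<and>
     lt A (mul A (add A (one A) (one A)) (add A (one A) (one A))) x \<and>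
     (\<forall>a\<in>cut A x. lt A (mul A a a) x \<and> lt A (mul A (mul A a a) (mul A a a)) x)"

lemma sat_theta_fm [simp]: "sat A e (theta_fm x) \<longleftrightarrow> theta A (eval A e x)"
  by (simp add: theta_fm_def theta_def Let_def)

lemma sat_rem_fm [simp]:
  "sat A e (rem_fm x r i u v) \<longleftrightarrow>
     cut_rem A (cut A (eval A e x)) (eval A e r) (eval A e i) (eval A e u) (eval A e v)"
  by (simp add: rem_fm_def cut_rem_def Let_def)

lemma sat_horner_fm [simp]:
  "sat A e (horner_fm x c k m) \<longleftrightarrow>
     horner A (cut A (eval A e x)) (eval A e c) (eval A e k) (eval A e m)"
  by (simp add: horner_fm_def horner_def Let_def eval_nat_numeral)

section \<open>Comparing coded elements through their values at almost all numbers\<close>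

definition evtl :: "'a interp \<Rightarrow> 'a set \<Rightarrow> ('a \<Rightarrow> bool) \<Rightarrow> bool" where
  "evtl A N P \<longleftrightarrow> (\<exists>l\<in>N. \<forall>k\<in>N. lt A l k \<longrightarrow> P k)"

definition evtl_fm :: "tm \<Rightarrow> fm \<Rightarrow> fm" where
  "evtl_fm x p = ExN x (AllN (shift 1 x) (Imp (Lt (Var 1) (Var 0)) p))"

lemma sat_evtl_fm:
  "sat A e (evtl_fm x p) \<longleftrightarrow>
     (\<exists>l\<in>cut A (eval A e x). \<forall>k\<in>cut A (eval A e x). lt A l k \<longrightarrow> sat A (case_nat k (case_nat l e)) p)"
  by (simp add: evtl_fm_def)

text \<open>The last conjunct is \<open>a = (y - k) b + m\<close> without subtraction; for \<open>y = X\<close> it says that the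
  polynomial \<open>a\<close> takes the value \<open>m\<close> at \<open>k\<close>.\<close>

definition code_fm :: "tm \<Rightarrow> tm \<Rightarrow> tm \<Rightarrow> tm \<Rightarrow> fm" where
  "code_fm x y c a = evtl_fm x (ExN (shift 2 x)
     (And (horner_fm (shift 3 x) (shift 3 c) (Var 1) (Var 0))
       (Exists (Eq (Add (shift 4 a) (Mul (Var 2) (Var 0))) (Add (Mul (shift 4 y) (Var 0)) (Var 1))))))"

definition code :: "'a interp \<Rightarrow> 'a set \<Rightarrow> 'a \<Rightarrow> 'a \<Rightarrow> 'a \<Rightarrow> bool" where
  "code A N y c a \<longleftrightarrow> evtl A N (\<lambda>k. \<exists>m\<in>N. horner A N c k m \<and>
     (\<exists>b\<in>universe A. add A a (mul A k b) = add A (mul A y b) m))"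

lemma sat_code_fm [simp]:
  "sat A e (code_fm x y c a) \<longleftrightarrow> code A (cut A (eval A e x)) (eval A e y) (eval A e c) (eval A e a)"
  by (simp add: code_fm_def code_def evtl_def sat_evtl_fm eval_nat_numeral)

text \<open>The values at \<open>k\<close> of the polynomials coded by \<open>c\<close>, \<open>c'\<close> and \<open>c''\<close>, for almost all \<open>k\<close>,
  satisfy \<open>p\<close>, where \<open>Var 2\<close>, \<open>Var 1\<close>, \<open>Var 0\<close> stand for these values. Unary and binary relations
  are treated as ternary ones by repeating codes.\<close>

definition rel_fm :: "tm \<Rightarrow> tm \<Rightarrow> tm \<Rightarrow> tm \<Rightarrow> fm \<Rightarrow> fm" where
  "rel_fm x c c' c'' p = evtl_fm x (ExN (shift 2 x) (ExN (shift 3 x) (ExN (shift 4 x)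
     (And (horner_fm (shift 5 x) (shift 5 c) (Var 3) (Var 2))
     (And (horner_fm (shift 5 x) (shift 5 c') (Var 3) (Var 1))
     (And (horner_fm (shift 5 x) (shift 5 c'') (Var 3) (Var 0)) p))))))"

definition code_rel :: "'a interp \<Rightarrow> 'a set \<Rightarrow> ('a \<Rightarrow> 'a \<Rightarrow> 'a \<Rightarrow> bool) \<Rightarrow> 'a \<Rightarrow> 'a \<Rightarrow> 'a \<Rightarrow> bool" where
  "code_rel A N R c c' c'' \<longleftrightarrow> evtl A N (\<lambda>k. \<exists>m\<in>N. \<exists>m'\<in>N. \<exists>m''\<in>N.
     horner A N c k m \<and> horner A N c' k m' \<and> horner A N c'' k m'' \<and> R m m' m'')"

lemma sat_rel_fm [simp]:
  assumes "\<And>m m' m'' e. sat A (case_nat m'' (case_nat m' (case_nat m e))) p \<longleftrightarrow> R m m' m''"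
  shows "sat A e (rel_fm x c c' c'' p) \<longleftrightarrow>
    code_rel A (cut A (eval A e x)) R (eval A e c) (eval A e c') (eval A e c'')"
  by (simp add: rel_fm_def code_rel_def evtl_def sat_evtl_fm eval_nat_numeral assms)

definition code_respects :: "'a interp \<Rightarrow> 'a set \<Rightarrow> 'a \<Rightarrow> ('a \<Rightarrow> 'a \<Rightarrow> 'a \<Rightarrow> bool) \<Rightarrow> bool" where
  "code_respects A N y R \<longleftrightarrow> (\<forall>c\<in>N. \<forall>c'\<in>N. \<forall>c''\<in>N.
     \<forall>a\<in>universe A. \<forall>a'\<in>universe A. \<forall>a''\<in>universe A.
     code A N y c a \<and> code A N y c' a' \<and> code A N y c'' a'' \<longrightarrow>
     (code_rel A N R c c' c'' \<longleftrightarrow> R a a' a''))"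

definition code_respects_fm :: "tm \<Rightarrow> tm \<Rightarrow> fm \<Rightarrow> fm" where
  "code_respects_fm x y p =
    AllN x (AllN (shift 1 x) (AllN (shift 2 x) (Forall (Forall (Forall (
      let c = Var 5; c' = Var 4; c'' = Var 3; x = shift 6 x; y = shift 6 y in
      Imp (And (code_fm x y c (Var 2)) (And (code_fm x y c' (Var 1)) (code_fm x y c'' (Var 0))))
        (Iff (rel_fm x c c' c'' p) p)))))))"

lemma sat_code_respects_fm:
  assumes "\<And>m m' m'' e. sat A (case_nat m'' (case_nat m' (case_nat m e))) p \<longleftrightarrow> R m m' m''"
  shows "sat A e (code_respects_fm x y p) \<longleftrightarrow>
    code_respects A (cut A (eval A e x)) (eval A e y) R"
  by (simp add: code_respects_fm_def code_respects_def Let_def eval_nat_numeral assms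
      sat_rel_fm[where R = R] iff_conv_conj_imp)


text \<open>The numbers coding an element are those whose Horner scheme is defined at almost all \<open>k\<close>.\<close>

definition codes :: "'a interp \<Rightarrow> 'a set \<Rightarrow> 'a set" where
  "codes A N = {c \<in> N. code_rel A N (\<lambda>_ _ _. True) c c c}"

definition AllC :: "tm \<Rightarrow> fm \<Rightarrow> fm" where
  "AllC x p = AllN x (Imp (rel_fm (shift 1 x) (Var 0) (Var 0) (Var 0) (Eq Zero Zero)) p)"

definition ExC :: "tm \<Rightarrow> fm \<Rightarrow> fm" where
  "ExC x p = ExN x (And (rel_fm (shift 1 x) (Var 0) (Var 0) (Var 0) (Eq Zero Zero)) p)"

lemma sat_AllC [simp]:
  "sat A e (AllC x p) \<longleftrightarrow> (\<forall>c\<in>codes A (cut A (eval A e x)). sat A (case_nat c e) p)"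
  by (auto simp: AllC_def codes_def sat_rel_fm[where R = "\<lambda>_ _ _. True"])

lemma sat_ExC [simp]:
  "sat A e (ExC x p) \<longleftrightarrow> (\<exists>c\<in>codes A (cut A (eval A e x)). sat A (case_nat c e) p)"
  by (auto simp: ExC_def codes_def sat_rel_fm[where R = "\<lambda>_ _ _. True"])

definition good :: "'a interp \<Rightarrow> 'a set \<Rightarrow> 'a \<Rightarrow> bool" where
  "good A N y \<longleftrightarrow>
     (\<forall>a\<in>universe A. \<exists>c\<in>codes A N. code A N y c a) \<and>
     (\<forall>c\<in>codes A N. \<exists>a\<in>universe A. code A N y c a) \<and>
     code_respects A N y (\<lambda>a b c. a = b) \<and>
     code_respects A N y (\<lambda>a b c. lt A a b) \<and>
     code_respects A N y (\<lambda>a b c. a = zero A) \<and>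
     code_respects A N y (\<lambda>a b c. a = one A) \<and>
     code_respects A N y (\<lambda>a b c. add A a b = c) \<and>
     code_respects A N y (\<lambda>a b c. mul A a b = c)"

definition good_fm :: "tm \<Rightarrow> tm \<Rightarrow> fm" where
  "good_fm x y =
    And (Forall (ExC (shift 1 x) (code_fm (shift 2 x) (shift 2 y) (Var 0) (Var 1))))
   (And (AllC x (Exists (code_fm (shift 2 x) (shift 2 y) (Var 1) (Var 0))))
   (And (code_respects_fm x y (Eq (Var 2) (Var 1)))
   (And (code_respects_fm x y (Lt (Var 2) (Var 1)))
   (And (code_respects_fm x y (Eq (Var 2) Zero))
   (And (code_respects_fm x y (Eq (Var 2) One))
   (And (code_respects_fm x y (Eq (Add (Var 2) (Var 1)) (Var 0)))
        (code_respects_fm x y (Eq (Mul (Var 2) (Var 1)) (Var 0)))))))))"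

lemma sat_good_fm [simp]:
  "sat A e (good_fm x y) \<longleftrightarrow> good A (cut A (eval A e x)) (eval A e y)"
  by (simp add: good_fm_def good_def eval_nat_numeral
      sat_code_respects_fm[where R = "\<lambda>a b c. a = b"]
      sat_code_respects_fm[where R = "\<lambda>a b c. lt A a b"]
      sat_code_respects_fm[where R = "\<lambda>a b c. a = zero A"]
      sat_code_respects_fm[where R = "\<lambda>a b c. a = one A"]
      sat_code_respects_fm[where R = "\<lambda>a b c. add A a b = c"]
      sat_code_respects_fm[where R = "\<lambda>a b c. mul A a b = c"])

text \<open>The parameter \<open>y\<close> plays the part of \<open>X\<close>. All \<open>x\<close>
  satisfying \<open>theta_fm\<close> are covered because each Sigma_1-sentence brings an
  \<open>x\<close> of its own; that there is one at all is left to those sentences.\<close>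

definition Phi :: fm where
  "Phi = Exists (Forall (Imp (theta_fm (Var 0)) (good_fm (Var 0) (Var 1))))"

lemma sat_Phi:
  "sat A e Phi \<longleftrightarrow> (\<exists>y\<in>universe A. \<forall>x\<in>universe A. theta A x \<longrightarrow> good A (cut A x) y)"
  by (simp add: Phi_def)

text \<open>\<open>tm_fm x f z t\<close>: \<open>z\<close> codes the value of \<open>t\<close> when the values of the variables are coded by \<open>f\<close>.\<close>

primrec tm_fm :: "tm \<Rightarrow> (nat \<Rightarrow> tm) \<Rightarrow> tm \<Rightarrow> tm \<Rightarrow> fm" where
  "tm_fm x f z (Var i) = rel_fm x (f i) z z (Eq (Var 2) (Var 1))"
| "tm_fm x f z Zero = rel_fm x z z z (Eq (Var 2) Zero)"
| "tm_fm x f z One = rel_fm x z z z (Eq (Var 2) One)"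
| "tm_fm x f z (Add s t) =
    ExC x (And (tm_fm (shift 1 x) (\<lambda>i. shift 1 (f i)) (Var 0) s)
      (ExC (shift 1 x) (And (tm_fm (shift 2 x) (\<lambda>i. shift 2 (f i)) (Var 0) t)
        (rel_fm (shift 2 x) (Var 1) (Var 0) (shift 2 z) (Eq (Add (Var 2) (Var 1)) (Var 0))))))"
| "tm_fm x f z (Mul s t) =
    ExC x (And (tm_fm (shift 1 x) (\<lambda>i. shift 1 (f i)) (Var 0) s)
      (ExC (shift 1 x) (And (tm_fm (shift 2 x) (\<lambda>i. shift 2 (f i)) (Var 0) t)
        (rel_fm (shift 2 x) (Var 1) (Var 0) (shift 2 z) (Eq (Mul (Var 2) (Var 1)) (Var 0))))))"

text \<open>In \<open>translate d p\<close> the variables below \<open>d\<close> stand for codes, and \<open>Var d\<close> for the parameter of the cut.\<close>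

primrec translate :: "nat \<Rightarrow> fm \<Rightarrow> fm" where
  "translate d (Eq s t) = ExC (Var d)
    (And (tm_fm (Var (Suc d)) (\<lambda>i. Var (Suc i)) (Var 0) s)
         (tm_fm (Var (Suc d)) (\<lambda>i. Var (Suc i)) (Var 0) t))"
| "translate d (Lt s t) = ExC (Var d) (ExC (Var (Suc d))
    (And (tm_fm (Var (Suc (Suc d))) (\<lambda>i. Var (Suc (Suc i))) (Var 1) s)
    (And (tm_fm (Var (Suc (Suc d))) (\<lambda>i. Var (Suc (Suc i))) (Var 0) t)
         (rel_fm (Var (Suc (Suc d))) (Var 1) (Var 0) (Var 0) (Lt (Var 2) (Var 1))))))"
| "translate d (Neg p) = Neg (translate d p)"
| "translate d (And p q) = And (translate d p) (translate d q)"
| "translate d (Or p q) = Or (translate d p) (translate d q)"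
| "translate d (Imp p q) = Imp (translate d p) (translate d q)"
| "translate d (Forall p) = AllC (Var d) (translate (Suc d) p)"
| "translate d (Exists p) = ExC (Var d) (translate (Suc d) p)"

section \<open>Correctness of the translation\<close>

lemma code_respectsD:
  "code_respects A N y R \<Longrightarrow> code A N y c a \<Longrightarrow> code A N y c' a' \<Longrightarrow> code A N y c'' a'' \<Longrightarrow>
    c \<in> codes A N \<Longrightarrow> c' \<in> codes A N \<Longrightarrow> c'' \<in> codes A N \<Longrightarrow>
    a \<in> universe A \<Longrightarrow> a' \<in> universe A \<Longrightarrow> a'' \<in> universe A \<Longrightarrow>
    code_rel A N R c c' c'' \<longleftrightarrow> R a a' a''"
  unfolding code_respects_def codes_def by blast

text \<open>The equality clause, applied to \<open>c\<close> against itself, ties both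
  \<open>a = a\<close> and \<open>a = b\<close> to the same statement about
  \<open>c\<close>.\<close>

lemma good_code_inj:
  assumes "good A N y" "c \<in> codes A N" "a \<in> universe A" "b \<in> universe A" "code A N y c a" "code A N y c b"
  shows "a = b"
  using code_respectsD[of A N y "\<lambda>a b c. a = b" c a c a c a] code_respectsD[of A N y "\<lambda>a b c. a = b" c a c b c a]
    assms unfolding good_def by blast

text \<open>Codes of the arguments exist, and which ones are taken is immaterial since the graph of
  \<open>h\<close> is respected. A general \<open>h\<close> covers both addition and
  multiplication.\<close>

lemma sat_binop:
  assumes good: "good A N y"
    and R: "code_respects A N y (\<lambda>a b c. h a b = c)" and h: "h a b \<in> universe A"
    and ab: "a \<in> universe A" "b \<in> universe A" and z: "z \<in> codes A N"
  shows "(\<exists>c\<in>codes A N. code A N y c a \<and> (\<exists>c'\<in>codes A N. code A N y c' b \<and>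
    code_rel A N (\<lambda>a b c. h a b = c) c c' z)) \<longleftrightarrow> code A N y z (h a b)"
proof -
  obtain d where d: "d \<in> universe A" "code A N y z d" using good z unfolding good_def by blast
  obtain c c' where c: "c \<in> codes A N" "c' \<in> codes A N" "code A N y c a" "code A N y c' b"
    using good ab unfolding good_def by blast
  have *: "code_rel A N (\<lambda>a b c. h a b = c) c c' z \<longleftrightarrow> h a b = d"
    if "c \<in> codes A N" "c' \<in> codes A N" "code A N y c a" "code A N y c' b" for c c'
    by (rule code_respectsD[OF R that(3,4) d(2) that(1,2) z ab d(1)])
  have "code A N y z (h a b) \<longleftrightarrow> h a b = d"
    using good_code_inj[OF good z h d(1) _ d(2)] d(2) by blast
  then show ?thesis using * c by blast
qed

text \<open>Some element is coded by \<open>z\<close>; the clauses of \<open>good\<close> decide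
  from the codes whether it is the value of the term.\<close>

lemma sat_tm_fm:
  assumes A: "is_interp A" and good: "good A N y" and g: "range g \<subseteq> universe A"
  shows "tm_below n t \<Longrightarrow> N = cut A (eval A e x) \<Longrightarrow>
    (\<And>i. i < n \<Longrightarrow> eval A e (f i) \<in> codes A N \<and> code A N y (eval A e (f i)) (g i)) \<Longrightarrow>
    eval A e z \<in> codes A N \<Longrightarrow>
    sat A e (tm_fm x f z t) \<longleftrightarrow> code A N y (eval A e z) (eval A g t)"
proof (induction t arbitrary: e x f z)
  case (Var i)
  then have i: "eval A e (f i) \<in> codes A N" "code A N y (eval A e (f i)) (g i)" by auto
  have gi: "g i \<in> universe A" using g by auto
  obtain d where d: "d \<in> universe A" "code A N y (eval A e z) d"
    using good Var.prems(4) unfolding good_def by blast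
  have "code_rel A N (\<lambda>a b c. a = b) (eval A e (f i)) (eval A e z) (eval A e z) \<longleftrightarrow> g i = d"
    using good i d gi Var.prems(4) by (intro code_respectsD) (auto simp: good_def)
  moreover have "code A N y (eval A e z) (g i) \<longleftrightarrow> g i = d"
    using good_code_inj[OF good Var.prems(4) gi d(1) _ d(2)] d(2) by blast
  ultimately show ?case
    using Var.prems(2) by (simp add: sat_rel_fm[where R = "\<lambda>a b c. a = b"] eval_nat_numeral)
next
  case Zero
  obtain d where d: "d \<in> universe A" "code A N y (eval A e z) d"
    using good Zero.prems(4) unfolding good_def by blast
  have z: "zero A \<in> universe A" using A by (simp add: is_interp_def)
  have "code_rel A N (\<lambda>a b c. a = zero A) (eval A e z) (eval A e z) (eval A e z) \<longleftrightarrow> d = zero A"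
    using good d Zero.prems(4) by (intro code_respectsD) (auto simp: good_def)
  moreover have "code A N y (eval A e z) (zero A) \<longleftrightarrow> d = zero A"
    using good_code_inj[OF good Zero.prems(4) z d(1) _ d(2)] d(2) by blast
  ultimately show ?case
    using Zero.prems(2) by (simp add: sat_rel_fm[where R = "\<lambda>a b c. a = zero A"] eval_nat_numeral)
next
  case One
  obtain d where d: "d \<in> universe A" "code A N y (eval A e z) d"
    using good One.prems(4) unfolding good_def by blast
  have z: "one A \<in> universe A" using A by (simp add: is_interp_def)
  have "code_rel A N (\<lambda>a b c. a = one A) (eval A e z) (eval A e z) (eval A e z) \<longleftrightarrow> d = one A"
    using good d One.prems(4) by (intro code_respectsD) (auto simp: good_def)
  moreover have "code A N y (eval A e z) (one A) \<longleftrightarrow> d = one A"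
    using good_code_inj[OF good One.prems(4) z d(1) _ d(2)] d(2) by blast
  ultimately show ?case
    using One.prems(2) by (simp add: sat_rel_fm[where R = "\<lambda>a b c. a = one A"] eval_nat_numeral)
next
  case (Add s t)
  have st: "eval A g s \<in> universe A" "eval A g t \<in> universe A"
    using eval_in_dom[OF A g] by auto
  have IH1: "sat A (case_nat c e) (tm_fm (shift (Suc 0) x) (\<lambda>i. shift (Suc 0) (f i)) (Var 0) s)
      \<longleftrightarrow> code A N y c (eval A g s)" if "c \<in> codes A N" for c
    using Add.IH(1)[of "case_nat c e" "shift (Suc 0) x" "\<lambda>i. shift (Suc 0) (f i)" "Var 0"] Add.prems that by simp
  have IH2: "sat A (case_nat c' (case_nat c e)) (tm_fm (shift (Suc (Suc 0)) x) (\<lambda>i. shift (Suc (Suc 0)) (f i)) (Var 0) t)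
      \<longleftrightarrow> code A N y c' (eval A g t)" if "c' \<in> codes A N" for c c'
    using Add.IH(2)[of "case_nat c' (case_nat c e)" "shift (Suc (Suc 0)) x" "\<lambda>i. shift (Suc (Suc 0)) (f i)" "Var 0"] Add.prems that by simp
  have "code_respects A N y (\<lambda>a b c. add A a b = c)" "add A (eval A g s) (eval A g t) \<in> universe A"
    using good A st by (simp_all add: good_def is_interp_def)
  note sat_binop[OF good this st Add.prems(4)]
  then show ?case
    by (simp add: IH1 IH2 sat_rel_fm[where R = "\<lambda>a b c. add A a b = c"] eval_nat_numeral
        flip: Add.prems(2))
next
  case (Mul s t)
  have st: "eval A g s \<in> universe A" "eval A g t \<in> universe A"
    using eval_in_dom[OF A g] by auto
  have IH1: "sat A (case_nat c e) (tm_fm (shift (Suc 0) x) (\<lambda>i. shift (Suc 0) (f i)) (Var 0) s)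
      \<longleftrightarrow> code A N y c (eval A g s)" if "c \<in> codes A N" for c
    using Mul.IH(1)[of "case_nat c e" "shift (Suc 0) x" "\<lambda>i. shift (Suc 0) (f i)" "Var 0"] Mul.prems that by simp
  have IH2: "sat A (case_nat c' (case_nat c e)) (tm_fm (shift (Suc (Suc 0)) x) (\<lambda>i. shift (Suc (Suc 0)) (f i)) (Var 0) t)
      \<longleftrightarrow> code A N y c' (eval A g t)" if "c' \<in> codes A N" for c c'
    using Mul.IH(2)[of "case_nat c' (case_nat c e)" "shift (Suc (Suc 0)) x" "\<lambda>i. shift (Suc (Suc 0)) (f i)" "Var 0"] Mul.prems that by simp
  have "code_respects A N y (\<lambda>a b c. mul A a b = c)" "mul A (eval A g s) (eval A g t) \<in> universe A"
    using good A st by (simp_all add: good_def is_interp_def)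
  note sat_binop[OF good this st Mul.prems(4)]
  then show ?case
    by (simp add: IH1 IH2 sat_rel_fm[where R = "\<lambda>a b c. mul A a b = c"] eval_nat_numeral
        flip: Mul.prems(2))
qed

text \<open>Here \<open>e'\<close> lists \<open>d\<close> codes followed by the parameter of the
  cut. Quantifiers over elements and over codes match because every element has a code and every
  code an element; by the induction hypothesis the choice of code does not affect truth.\<close>

lemma sat_translate:
  assumes A: "is_interp A" and good: "good A N y"
  shows "fm_below d p \<Longrightarrow> range e \<subseteq> universe A \<Longrightarrow> N = cut A (e' d) \<Longrightarrow>
    (\<And>i. i < d \<Longrightarrow> e' i \<in> codes A N \<and> code A N y (e' i) (e i)) \<Longrightarrow>
    sat A e' (translate d p) \<longleftrightarrow> sat A e p"
proof (induction p arbitrary: d e e')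
  case (Eq s t)
  have st: "eval A e s \<in> universe A" "eval A e t \<in> universe A"
    using eval_in_dom[OF A Eq.prems(2)] by auto
  have tm: "sat A (case_nat c e') (tm_fm (Var (Suc d)) (\<lambda>i. Var (Suc i)) (Var 0) t) \<longleftrightarrow> code A N y c (eval A e t)"
    if "c \<in> codes A N" "tm_below d t" for c t
    using sat_tm_fm[OF A good Eq.prems(2) that(2)] that Eq.prems by simp
  have "sat A e' (translate d (Eq s t)) \<longleftrightarrow>
      (\<exists>c\<in>codes A N. code A N y c (eval A e s) \<and> code A N y c (eval A e t))"
    using Eq.prems(1) by (simp add: tm flip: Eq.prems(3))
  also have "\<dots> \<longleftrightarrow> eval A e s = eval A e t"
    using st good good_code_inj[OF good] unfolding good_def by metis
  finally show ?case by simp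
next
  case (Lt s t)
  have st: "eval A e s \<in> universe A" "eval A e t \<in> universe A"
    using eval_in_dom[OF A Lt.prems(2)] by auto
  have tm: "sat A (case_nat c' (case_nat c e')) (tm_fm (Var (Suc (Suc d))) (\<lambda>i. Var (Suc (Suc i))) z t) \<longleftrightarrow>
      code A N y (eval A (case_nat c' (case_nat c e')) z) (eval A e t)"
    if "eval A (case_nat c' (case_nat c e')) z \<in> codes A N" "tm_below d t" for c c' t z
    using sat_tm_fm[OF A good Lt.prems(2) that(2)] that Lt.prems by simp
  have "sat A e' (translate d (Lt s t)) \<longleftrightarrow>
      (\<exists>c\<in>codes A N. \<exists>c'\<in>codes A N. code A N y c (eval A e s) \<and> code A N y c' (eval A e t) \<and>
        code_rel A N (\<lambda>a b c. lt A a b) c c' c')"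
    using Lt.prems(1) by (simp add: tm sat_rel_fm[where R = "\<lambda>a b c. lt A a b"] eval_nat_numeral
        flip: Lt.prems(3))
  also have "\<dots> \<longleftrightarrow> (\<exists>c\<in>codes A N. \<exists>c'\<in>codes A N. code A N y c (eval A e s) \<and> code A N y c' (eval A e t) \<and>
        lt A (eval A e s) (eval A e t))"
    using good st code_respectsD[of A N y "\<lambda>a b c. lt A a b"] unfolding good_def by meson
  also have "\<dots> \<longleftrightarrow> lt A (eval A e s) (eval A e t)"
    using st good unfolding good_def by blast
  finally show ?case by simp
next
  case (Forall p)
  have IH: "sat A (case_nat c e') (translate (Suc d) p) \<longleftrightarrow> sat A (case_nat a e) p"
    if "c \<in> codes A N" "a \<in> universe A" "code A N y c a" for c a
    by (rule Forall.IH) (use Forall.prems that in \<open>auto simp: image_subset_iff split: nat.split\<close>)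
  have "sat A e' (translate d (Forall p)) \<longleftrightarrow> (\<forall>c\<in>codes A N. sat A (case_nat c e') (translate (Suc d) p))"
    by (simp flip: Forall.prems(3))
  also have "\<dots> \<longleftrightarrow> (\<forall>a\<in>universe A. sat A (case_nat a e) p)"
    using good IH unfolding good_def by metis
  finally show ?case by simp
next
  case (Exists p)
  have IH: "sat A (case_nat c e') (translate (Suc d) p) \<longleftrightarrow> sat A (case_nat a e) p"
    if "c \<in> codes A N" "a \<in> universe A" "code A N y c a" for c a
    by (rule Exists.IH) (use Exists.prems that in \<open>auto simp: image_subset_iff split: nat.split\<close>)
  have "sat A e' (translate d (Exists p)) \<longleftrightarrow> (\<exists>c\<in>codes A N. sat A (case_nat c e') (translate (Suc d) p))"
    by (simp flip: Exists.prems(3))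
  also have "\<dots> \<longleftrightarrow> (\<exists>a\<in>universe A. sat A (case_nat a e) p)"
    using good IH unfolding good_def by metis
  finally show ?case by simp
qed auto

section \<open>Complexity and free variables of the formulas\<close>

lemma delta0_AllN: "delta0 p \<Longrightarrow> delta0 (AllN x p)"
  unfolding AllN_def by (intro delta0.intros)

lemma delta0_ExN: "delta0 p \<Longrightarrow> delta0 (ExN x p)"
  unfolding ExN_def by (intro delta0.intros)

lemmas delta0_rules = delta0.intros(1-6) delta0_AllN delta0_ExN

lemma delta0_theta_fm: "delta0 (theta_fm x)"
  unfolding theta_fm_def Let_def by (intro delta0_rules)

lemma delta0_rem_fm: "delta0 (rem_fm x r i u v)"
  unfolding rem_fm_def Let_def by (intro delta0_rules)

lemma delta0_horner_fm: "delta0 (horner_fm x c k m)"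
  unfolding horner_fm_def Let_def by (intro delta0_rules delta0_rem_fm)

lemma delta0_rel_fm: "delta0 p \<Longrightarrow> delta0 (rel_fm x c c' c'' p)"
  unfolding rel_fm_def evtl_fm_def by (intro delta0_rules delta0_horner_fm)

lemma delta0_AllC: "delta0 p \<Longrightarrow> delta0 (AllC x p)"
  unfolding AllC_def by (intro delta0_rules delta0_rel_fm)

lemma delta0_ExC: "delta0 p \<Longrightarrow> delta0 (ExC x p)"
  unfolding ExC_def by (intro delta0_rules delta0_rel_fm)

lemma delta0_tm_fm: "delta0 (tm_fm x f z t)"
  by (induction t arbitrary: x f z) (auto intro!: delta0_rules delta0_rel_fm delta0_ExC)

lemma delta0_translate: "delta0 (translate d p)"
  by (induction p arbitrary: d)
    (auto intro!: delta0_rules delta0_rel_fm delta0_ExC delta0_AllC delta0_tm_fm)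

lemma tm_below_shift_Suc [simp]: "tm_below (Suc n) (shift (Suc m) t) = tm_below n (shift m t)"
  by (induction t) auto

lemma fm_below_AllN [simp]: "fm_below n (AllN x p) \<longleftrightarrow> tm_below n x \<and> fm_below (Suc n) p"
  by (auto simp: AllN_def)

lemma fm_below_ExN [simp]: "fm_below n (ExN x p) \<longleftrightarrow> tm_below n x \<and> fm_below (Suc n) p"
  by (auto simp: ExN_def)

lemma fm_below_theta_fm [simp]: "fm_below n (theta_fm x) \<longleftrightarrow> tm_below n x"
  by (auto simp: theta_fm_def Let_def)

lemma fm_below_rem_fm [simp]: "fm_below n (rem_fm x r i u v) \<longleftrightarrow>
    tm_below n x \<and> tm_below n r \<and> tm_below n i \<and> tm_below n u \<and> tm_below n v"
  by (auto simp: rem_fm_def Let_def)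

lemma fm_below_horner_fm [simp]: "fm_below n (horner_fm x c k m) \<longleftrightarrow>
    tm_below n x \<and> tm_below n c \<and> tm_below n k \<and> tm_below n m"
  by (auto simp: horner_fm_def Let_def pair_tm_def eval_nat_numeral)

lemma fm_below_evtl_fm [simp]: "fm_below n (evtl_fm x p) \<longleftrightarrow> tm_below n x \<and> fm_below (Suc (Suc n)) p"
  by (auto simp: evtl_fm_def)

lemma fm_below_code_fm [simp]: "fm_below n (code_fm x y c a) \<longleftrightarrow>
    tm_below n x \<and> tm_below n y \<and> tm_below n c \<and> tm_below n a"
  by (auto simp: code_fm_def eval_nat_numeral)

lemma fm_below_rel_fm [simp]: "fm_below n (rel_fm x c c' c'' p) \<longleftrightarrow>
    tm_below n x \<and> tm_below n c \<and> tm_below n c' \<and> tm_below n c'' \<and> fm_below (5 + n) p"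
  by (auto simp: rel_fm_def eval_nat_numeral)

lemma fm_below_AllC [simp]: "fm_below n (AllC x p) \<longleftrightarrow> tm_below n x \<and> fm_below (Suc n) p"
  by (auto simp: AllC_def)

lemma fm_below_ExC [simp]: "fm_below n (ExC x p) \<longleftrightarrow> tm_below n x \<and> fm_below (Suc n) p"
  by (auto simp: ExC_def)

lemma sentence_Phi: "sentence Phi"
  by (simp add: sentence_def Phi_def good_fm_def code_respects_fm_def Let_def eval_nat_numeral)

lemma fm_below_tm_fm:
  "tm_below d t \<Longrightarrow> tm_below n x \<Longrightarrow> tm_below n z \<Longrightarrow> (\<And>i. i < d \<Longrightarrow> tm_below n (f i)) \<Longrightarrow>
    fm_below n (tm_fm x f z t)"
  by (induction t arbitrary: n x f z) (simp_all add: eval_nat_numeral)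

lemma fm_below_translate: "fm_below d p \<Longrightarrow> fm_below (Suc d) (translate d p)"
  by (induction p arbitrary: d) (auto intro!: fm_below_tm_fm)

section \<open>The standard cut of the nonnegative polynomials\<close>

abbreviation "X \<equiv> [:0, 1::int:]"

abbreviation "NN \<equiv> range (of_nat :: nat \<Rightarrow> int poly)"

text \<open>Closure under squaring keeps the elements of the cut standard: the degrees of the iterated
  squares of a nonstandard one would exceed the degree of \<open>x\<close>.\<close>

lemma cut_M:
  assumes x: "0 \<le> x" and th: "theta M x"
  shows "cut M x = NN"
proof -
  have pow: "a ^ (2 ^ j) \<in> cut M x" if "a \<in> cut M x" for a j
  proof (induction j)
    case (Suc j)
    have "a ^ (2 ^ Suc j) = a ^ (2 ^ j) * a ^ (2 ^ j)"
      by (simp add: power_add mult_2)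
    then show ?case using Suc th by (simp add: theta_def cut_def)
  qed (use that in simp)
  show ?thesis
  proof (intro equalityI subsetI)
    fix a assume a: "a \<in> cut M x"
    then have a0: "0 \<le> a" by (simp add: cut_def)
    have "degree a = 0"
    proof (rule ccontr)
      assume d: "degree a \<noteq> 0"
      have "degree (a ^ (2 ^ degree x)) \<le> degree x"
        using pow[OF a, of "degree x"] a0 by (intro degree_mono_nonneg) (auto simp: cut_def)
      moreover have "2 ^ degree x * 1 \<le> 2 ^ degree x * degree a" using d by (intro mult_le_mono) auto
      moreover have "degree x < 2 ^ degree x" by (rule less_exp)
      moreover have "a \<noteq> 0" using d by auto
      ultimately show False by (simp add: degree_power_eq)
    qed
    then show "a \<in> NN" using int_poly_degree_0[OF a0] by auto
  next
    fix a assume "a \<in> NN"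
    then obtain n where n: "a = of_nat n" by auto
    \<comment> \<open>An iterated square of 2, hence in the cut, and above \<open>n\<close>; the cut
      is closed downwards.\<close>
    define b :: "int poly" where "b = of_nat (2 ^ (2 ^ n))"
    have "of_nat 2 \<in> cut M x" using th by (simp add: theta_def cut_def)
    then have b: "b \<in> cut M x" using pow[of "of_nat 2" n] by (simp add: b_def)
    have "n < 2 ^ n" "(2::nat) ^ n < 2 ^ (2 ^ n)" by (rule less_exp)+
    then have "n \<le> 2 ^ (2 ^ n)" by linarith
    then have ab: "a \<le> b" unfolding n b_def by (simp only: of_nat_le_iff)
    moreover have "a * a \<le> b * b" using ab n by (intro mult_mono) (auto simp: b_def)
    ultimately show "a \<in> cut M x" using b n by (auto simp: cut_def)
  qed
qed

lemma of_nat_less_X: "of_nat n < X"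
  by (simp add: less_poly_def pos_poly_def of_nat_poly)

text \<open>If the square of an element is below \<open>X\<close>, its degree is at most 1 and even,
  so the element is standard.\<close>

lemma theta_X: "theta M X"
proof -
  have "a * a < X \<and> a * a * (a * a) < X" if a: "a \<in> cut M X" for a
  proof -
    have "0 \<le> a" "a * a < X" using a by (simp_all add: cut_def)
    then have "degree (a * a) \<le> degree X" by (intro degree_mono_nonneg) auto
    then have "degree a = 0" by (cases "a = 0") (auto simp: degree_mult_eq)
    then obtain n where "a = of_nat n" using \<open>0 \<le> a\<close> int_poly_degree_0 by blast
    then show ?thesis using of_nat_less_X[of "n * n"] of_nat_less_X[of "n * n * (n * n)"] by simp
  qed
  then show ?thesis
    using of_nat_less_X[of 2] of_nat_less_X[of 4] by (simp add: theta_def)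
qed

lemma evtl_NN: "evtl M NN P \<longleftrightarrow> (\<forall>\<^sub>F k in sequentially. P (of_nat k))"
  by (auto simp: evtl_def eventually_at_top_dense)

section \<open>Eventual signs of polynomials\<close>

text \<open>Once the tail takes a value of at least 1, multiplying it by some \<open>k\<close> above
  \<open>\<bar>a\<bar>\<close> outweighs the constant term \<open>a\<close>.\<close>

lemma eventually_poly_pos:
  assumes "0 < (p :: int poly)"
  shows "\<forall>\<^sub>F k in sequentially. 0 < poly p (int k)"
  using assms
proof (induction p)
  case (pCons a p)
  show ?case
  proof (cases "p = 0")
    case True
    then show ?thesis using pCons.prems by (simp add: zero_less_poly_iff)
  next
    case False
    then have "0 < p" using pCons.prems by (simp add: zero_less_poly_iff)
    then have "\<forall>\<^sub>F k in sequentially. 0 < poly p (int k)" by (rule pCons.IH)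
    moreover have "\<forall>\<^sub>F k in sequentially. nat \<bar>a\<bar> < k" by (rule eventually_gt_at_top)
    ultimately show ?thesis
    proof eventually_elim
      case (elim k)
      have "int k * 1 \<le> int k * poly p (int k)" using elim by (intro mult_left_mono) auto
      moreover have "- int k < a" using elim by linarith
      ultimately have "0 < a + int k * poly p (int k)" by linarith
      then show ?case by simp
    qed
  qed
qed simp

lemma eventually_poly_less: "(\<forall>\<^sub>F k in sequentially. poly p (int k) < poly q (int k)) \<longleftrightarrow> p < q"
proof
  assume L: "\<forall>\<^sub>F k in sequentially. poly p (int k) < poly q (int k)"
  show "p < q"
  proof (rule ccontr)
    assume "\<not> p < q"
    then consider "p = q" | "0 < p - q" by fastforce
    then show False
    proof cases
      case 2
      then have "\<forall>\<^sub>F k in sequentially. 0 < poly (p - q) (int k)" by (rule eventually_poly_pos)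
      with L have "\<forall>\<^sub>F k :: nat in sequentially. False" by eventually_elim auto
      then show False by simp
    qed (use L in simp)
  qed
next
  assume "p < q"
  then have "\<forall>\<^sub>F k in sequentially. 0 < poly (q - p) (int k)" by (intro eventually_poly_pos) simp
  then show "\<forall>\<^sub>F k in sequentially. poly p (int k) < poly q (int k)"
    by eventually_elim simp
qed

lemma eventually_poly_le: "(\<forall>\<^sub>F k in sequentially. poly p (int k) \<le> poly q (int k)) \<longleftrightarrow> p \<le> q"
proof
  assume L: "\<forall>\<^sub>F k in sequentially. poly p (int k) \<le> poly q (int k)"
  show "p \<le> q"
  proof (rule ccontr)
    assume "\<not> p \<le> q"
    then have "\<forall>\<^sub>F k in sequentially. poly q (int k) < poly p (int k)"
      by (subst eventually_poly_less) simp
    with L have "\<forall>\<^sub>F k :: nat in sequentially. False" by eventually_elim auto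
    then show False by simp
  qed
next
  assume "p \<le> q"
  then consider "p = q" | "p < q" by fastforce
  then show "\<forall>\<^sub>F k in sequentially. poly p (int k) \<le> poly q (int k)"
  proof cases
    case 2
    then have "\<forall>\<^sub>F k in sequentially. poly p (int k) < poly q (int k)"
      by (simp add: eventually_poly_less)
    then show ?thesis by eventually_elim simp
  qed simp
qed

lemma eventually_poly_eq: "(\<forall>\<^sub>F k in sequentially. poly p (int k) = poly q (int k)) \<longleftrightarrow> p = q"
  using eventually_poly_le[of p q] eventually_poly_le[of q p]
  by (simp add: order.eq_iff eventually_conj_iff)

section \<open>Numerical codes of polynomials\<close>

definition gmod :: "nat \<Rightarrow> nat \<Rightarrow> nat \<Rightarrow> nat" where
  "gmod u v i = u mod Suc (Suc i * v)"

lemma gmod_coding: "\<exists>u v. \<forall>i<n. gmod u v i = f i"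
proof -
  obtain u v :: int where uv: "0 \<le> u" "0 \<le> v" and *: "\<And>i. i < n \<Longrightarrow>
    \<exists>q\<ge>0. u = q * (1 + (of_nat i + 1) * v) + int (f i) \<and> int (f i) \<le> (of_nat i + 1) * v"
    using beta_coding[of n "\<lambda>i. int (f i)"] by auto
  have "gmod (nat u) (nat v) i = f i" if "i < n" for i
  proof -
    obtain q where q: "u = q * (1 + (int i + 1) * v) + int (f i)" "int (f i) \<le> (int i + 1) * v"
      using *[OF \<open>i < n\<close>] by auto
    have "int (gmod (nat u) (nat v) i) = u mod (1 + (int i + 1) * v)"
      using uv by (simp add: gmod_def zmod_int algebra_simps)
    also have "\<dots> = int (f i)" using q by simp
    finally show ?thesis by simp
  qed
  then show ?thesis by blast
qed

lemma cut_rem_NN: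
  "cut_rem M NN (of_nat r) (of_nat i) (of_nat u) (of_nat v) \<longleftrightarrow> r = gmod u v i"
proof -
  have "cut_rem M NN (of_nat r) (of_nat i) (of_nat u) (of_nat v) \<longleftrightarrow>
      (\<exists>q. (of_nat u :: int poly) = of_nat (q * Suc (Suc i * v) + r) \<and>
        (of_nat r :: int poly) \<le> of_nat (Suc i * v))"
    by (auto simp: cut_rem_def Let_def order.order_iff_strict algebra_simps)
  also have "\<dots> \<longleftrightarrow> (\<exists>q. u = q * Suc (Suc i * v) + r \<and> r \<le> Suc i * v)"
    by (simp only: of_nat_eq_iff of_nat_le_iff)
  also have "\<dots> \<longleftrightarrow> r = gmod u v i"
  proof
    assume "r = gmod u v i"
    moreover have "u = u div Suc (Suc i * v) * Suc (Suc i * v) + u mod Suc (Suc i * v)"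
      by (rule div_mult_mod_eq[symmetric])
    moreover have "u mod Suc (Suc i * v) \<le> Suc i * v" by (metis less_Suc_eq_le mod_less_divisor zero_less_Suc)
    ultimately show "\<exists>q. u = q * Suc (Suc i * v) + r \<and> r \<le> Suc i * v"
      unfolding gmod_def by blast
  qed (auto simp: gmod_def simp del: mult_Suc mult_Suc_right)
  finally show ?thesis .
qed

definition npair :: "nat \<Rightarrow> nat \<Rightarrow> nat" where
  "npair x y = (x + y)\<^sup>2 + x"

lemma pair_of_nat: "pair M (of_nat x) (of_nat y) = of_nat (npair x y)"
  by (simp add: pair_M npair_def)

lemma npair_inject: "npair x y = npair x' y' \<longleftrightarrow> x = x' \<and> y = y'"
  using pair_M_inject[of "of_nat x" "of_nat y" "of_nat x'" "of_nat y'"] by (simp add: pair_of_nat)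

definition npoly :: "nat \<Rightarrow> nat \<Rightarrow> nat \<Rightarrow> nat \<Rightarrow> nat" where
  "npoly n u v g = npair n (npair u (npair v g))"

lemma npoly_inject: "npoly n u v g = npoly n' u' v' g' \<longleftrightarrow> n = n' \<and> u = u' \<and> v = v' \<and> g = g'"
  by (simp add: npoly_def npair_inject)

text \<open>The coefficients are offset by \<open>g\<close> so that natural numbers suffice to code them.\<close>

primrec hsum :: "(nat \<Rightarrow> nat) \<Rightarrow> nat \<Rightarrow> nat \<Rightarrow> int poly" where
  "hsum f g 0 = 0"
| "hsum f g (Suc i) = pCons (int (f i) - int g) (hsum f g i)"

text \<open>Every partial result of Horner's scheme has to be a natural number at almost all
  \<open>k\<close>, so all the leading segments of the polynomial must be nonnegative, not only
  \<open>p\<close>.\<close>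

definition decode :: "nat \<Rightarrow> int poly \<Rightarrow> bool" where
  "decode c p \<longleftrightarrow> (\<exists>n u v g. c = npoly n u v g \<and> p = hsum (gmod u v) g n \<and>
     (\<forall>i\<le>n. 0 \<le> hsum (gmod u v) g i))"

text \<open>The recursion, read in the integers, evaluates \<open>hsum f g i\<close> at
  \<open>k\<close>. A sequence of natural numbers satisfies it exactly when none of these values is
  negative.\<close>

lemma horner_scheme:
  "(\<exists>t. t 0 = 0 \<and> t n = m \<and> (\<forall>i<n. t (Suc i) + g = k * t i + f i)) \<longleftrightarrow>
    poly (hsum f g n) (int k) = int m \<and> (\<forall>i\<le>n. 0 \<le> poly (hsum f g i) (int k))"
proof
  assume "\<exists>t. t 0 = 0 \<and> t n = m \<and> (\<forall>i<n. t (Suc i) + g = k * t i + f i)"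
  then obtain t where t: "t 0 = 0" "t n = m" "\<And>i. i < n \<Longrightarrow> t (Suc i) + g = k * t i + f i"
    by blast
  have "poly (hsum f g i) (int k) = int (t i)" if "i \<le> n" for i
    using that
  proof (induction i)
    case (Suc i)
    then have "int (t (Suc i) + g) = int (k * t i + f i)" using t(3)[of i] by simp
    then show ?case using Suc by simp
  qed (use t in simp)
  then show "poly (hsum f g n) (int k) = int m \<and> (\<forall>i\<le>n. 0 \<le> poly (hsum f g i) (int k))"
    using t(2) by simp
next
  assume R: "poly (hsum f g n) (int k) = int m \<and> (\<forall>i\<le>n. 0 \<le> poly (hsum f g i) (int k))"
  define t where "t i = nat (poly (hsum f g i) (int k))" for i
  have t: "int (t i) = poly (hsum f g i) (int k)" if "i \<le> n" for i
    using R that by (simp add: t_def)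
  have "t (Suc i) + g = k * t i + f i" if "i < n" for i
  proof -
    have "int (t (Suc i) + g) = int (k * t i + f i)" using t[of i] t[of "Suc i"] that by simp
    then show ?thesis by (simp only: of_nat_eq_iff)
  qed
  moreover have "t 0 = 0" "t n = m" using R by (simp_all add: t_def)
  ultimately show "\<exists>t. t 0 = 0 \<and> t n = m \<and> (\<forall>i<n. t (Suc i) + g = k * t i + f i)"
    by blast
qed

lemma horner_NN:
  "horner M NN (of_nat c) (of_nat k) (of_nat m) \<longleftrightarrow>
    (\<exists>n u v g. c = npoly n u v g \<and> poly (hsum (gmod u v) g n) (int k) = int m \<and>
      (\<forall>i\<le>n. 0 \<le> poly (hsum (gmod u v) g i) (int k)))"
proof -
  have rem0: "cut_rem M NN 0 0 (of_nat u) (of_nat v) \<longleftrightarrow> gmod u v 0 = 0" for u v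
    using cut_rem_NN[of 0 0 u v] by auto
  have remS: "cut_rem M NN (of_nat r) (of_nat i + 1) (of_nat u) (of_nat v) \<longleftrightarrow> r = gmod u v (Suc i)" for r i u v
    using cut_rem_NN[of r "Suc i" u v] by (simp add: add.commute)
  have arith: "of_nat t' + of_nat g = of_nat k * of_nat t + (of_nat a :: int poly) \<longleftrightarrow> t' + g = k * t + a" for t' g t a
    by (simp only: of_nat_eq_iff flip: of_nat_add of_nat_mult)
  have "horner M NN (of_nat c) (of_nat k) (of_nat m) \<longleftrightarrow>
      (\<exists>n u v g. c = npoly n u v g \<and> (\<exists>u' v'. gmod u' v' 0 = 0 \<and> gmod u' v' n = m \<and>
        (\<forall>i<n. gmod u' v' (Suc i) + g = k * gmod u' v' i + gmod u v i)))"
    unfolding horner_def by (simp add: pair_of_nat npoly_def rem0 remS cut_rem_NN arith eq_commute[of m] cong: conj_cong)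
  also have "\<dots> \<longleftrightarrow> (\<exists>n u v g. c = npoly n u v g \<and>
      (\<exists>t. t 0 = 0 \<and> t n = m \<and> (\<forall>i<n. t (Suc i) + g = k * t i + gmod u v i)))"
  proof -
    have "(\<exists>u' v'. gmod u' v' 0 = 0 \<and> gmod u' v' n = m \<and>
        (\<forall>i<n. gmod u' v' (Suc i) + g = k * gmod u' v' i + gmod u v i)) \<longleftrightarrow>
      (\<exists>t. t 0 = 0 \<and> t n = m \<and> (\<forall>i<n. t (Suc i) + g = k * t i + gmod u v i))" for n u v g
    proof
      assume "\<exists>t. t 0 = 0 \<and> t n = m \<and> (\<forall>i<n. t (Suc i) + g = k * t i + gmod u v i)"
      then obtain t where t: "t 0 = 0" "t n = m" "\<And>i. i < n \<Longrightarrow> t (Suc i) + g = k * t i + gmod u v i"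
        by blast
      obtain u' v' where "\<And>i. i < Suc n \<Longrightarrow> gmod u' v' i = t i"
        using gmod_coding[of "Suc n" t] by blast
      then show "\<exists>u' v'. gmod u' v' 0 = 0 \<and> gmod u' v' n = m \<and>
        (\<forall>i<n. gmod u' v' (Suc i) + g = k * gmod u' v' i + gmod u v i)"
        using t by (intro exI[of _ u'] exI[of _ v']) simp
    qed blast
    then show ?thesis by simp
  qed
  finally show ?thesis by (simp only: horner_scheme)
qed

lemma decode_nonneg: "decode c p \<Longrightarrow> 0 \<le> p"
  by (auto simp: decode_def)

lemma decode_exists:
  assumes "0 \<le> p"
  shows "\<exists>c. decode c p"
proof -
  \<comment> \<open>A bound for the absolute values of all coefficients; inserting 0 keeps the set
    nonempty when \<open>p\<close> is 0.\<close>
  define g where "g = nat (Max (abs ` insert 0 (set (coeffs p))))"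
  have g: "- int g \<le> coeff p i" for i
  proof -
    have "coeff p i \<in> insert 0 (set (coeffs p))" by (metis range_coeff rangeI)
    then have "\<bar>coeff p i\<bar> \<le> Max (abs ` insert 0 (set (coeffs p)))" by (intro Max_ge) auto
    then show ?thesis unfolding g_def by linarith
  qed
  define n where "n = Suc (degree p)"
  define f where "f i = nat (coeff p (n - Suc i) + int g)" for i
  obtain u v where uv: "\<And>i. i < n \<Longrightarrow> gmod u v i = f i" using gmod_coding[of n f] by blast
  have h: "hsum (gmod u v) g i = poly_shift (n - i) p" if "i \<le> n" for i
    using that
  proof (induction i)
    case 0
    show ?case by (rule poly_eqI) (simp add: coeff_poly_shift n_def coeff_eq_0)
  next
    case (Suc i)
    show ?case
    proof (rule poly_eqI)
      fix j
      have "int (f i) - int g = coeff p (n - Suc i)" using g[of "n - Suc i"] by (simp add: f_def)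
      moreover have "n - i = Suc (n - Suc i)" using Suc.prems by simp
      ultimately show "coeff (hsum (gmod u v) g (Suc i)) j = coeff (poly_shift (n - Suc i) p) j"
        using Suc uv[of i] by (cases j) (simp_all add: coeff_poly_shift)
    qed
  qed
  \<comment> \<open>Cutting off low coefficients leaves either 0 or a polynomial with the leading
    coefficient of \<open>p\<close>.\<close>
  have "0 \<le> poly_shift i p" for i
  proof (cases "poly_shift i p = 0")
    case False
    have le: "i \<le> degree p"
    proof (rule ccontr)
      assume "\<not> i \<le> degree p"
      then have "poly_shift i p = 0" by (intro poly_eqI) (simp add: coeff_poly_shift coeff_eq_0)
      then show False using False by simp
    qed
    have "degree (poly_shift i p) = degree p - i"
    proof (rule antisym)
      show "degree (poly_shift i p) \<le> degree p - i"
        by (rule degree_le) (simp add: coeff_poly_shift coeff_eq_0)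
      have "p \<noteq> 0" using False by auto
      then show "degree p - i \<le> degree (poly_shift i p)"
        using le by (intro le_degree) (simp add: coeff_poly_shift)
    qed
    then have "lead_coeff (poly_shift i p) = lead_coeff p" using le by (simp add: coeff_poly_shift)
    then show ?thesis using assms zero_le_poly_iff[of p] zero_le_poly_iff[of "poly_shift i p"] by simp
  qed simp
  then have "decode (npoly n u v g) p"
    unfolding decode_def using h by (intro exI[of _ n] exI[of _ u] exI[of _ v] exI[of _ g]) simp
  then show ?thesis ..
qed

text \<open>Each of the finitely many partial results is nonnegative at almost all \<open>k\<close>,
  hence all are so simultaneously.\<close>

lemma decode_horner:
  assumes "decode c p"
  shows "\<forall>\<^sub>F k in sequentially. 0 \<le> poly p (int k) \<and>
    (\<forall>m. horner M NN (of_nat c) (of_nat k) (of_nat m) \<longleftrightarrow> poly p (int k) = int m)"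
proof -
  obtain n u v g where c: "c = npoly n u v g" "p = hsum (gmod u v) g n"
    "\<And>i. i \<le> n \<Longrightarrow> 0 \<le> hsum (gmod u v) g i"
    using assms by (auto simp: decode_def)
  have "\<forall>\<^sub>F k in sequentially. 0 \<le> poly (hsum (gmod u v) g i) (int k)" if "i \<le> n" for i
    using eventually_poly_le[of 0] c(3)[OF that] by simp
  then have "\<forall>\<^sub>F k in sequentially. \<forall>i\<in>{..n}. 0 \<le> poly (hsum (gmod u v) g i) (int k)"
    by (intro eventually_ball_finite) auto
  then show ?thesis
    by eventually_elim (auto simp: horner_NN c(1,2) npoly_inject)
qed

text \<open>A single \<open>k\<close> reveals that \<open>c\<close> has the form
  \<open>npoly n u v g\<close>. By injectivity the same numbers serve for all \<open>k\<close>, and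
  eventual nonnegativity of the values gives that of the polynomials.\<close>

lemma horner_decode:
  assumes "\<forall>\<^sub>F k in sequentially. \<exists>m. horner M NN (of_nat c) (of_nat k) (of_nat m)"
  shows "\<exists>p. decode c p"
proof -
  obtain k m where "horner M NN (of_nat c) (of_nat k) (of_nat m)"
    using assms by (auto simp: eventually_sequentially)
  then obtain n u v g where c: "c = npoly n u v g"
    unfolding horner_NN by blast
  have "0 \<le> hsum (gmod u v) g i" if "i \<le> n" for i
  proof -
    have "\<forall>\<^sub>F k in sequentially. 0 \<le> poly (hsum (gmod u v) g i) (int k)"
      using assms by eventually_elim (use that in \<open>auto simp: horner_NN c npoly_inject\<close>)
    then show ?thesis using eventually_poly_le[of 0] by simp
  qed
  then show ?thesis using c by (auto simp: decode_def)
qed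

text \<open>The witness \<open>b\<close> is the quotient of \<open>a\<close> by
  \<open>X - k\<close>. Were it negative, it would be at most -1, giving \<open>a\<close> at most
  \<open>m + k - X\<close>, which is negative as \<open>X\<close> exceeds all standard
  numbers.\<close>

lemma value_at:
  assumes a: "0 \<le> a"
  shows "(\<exists>b\<ge>0. a + of_nat k * b = X * b + of_nat m) \<longleftrightarrow> poly a (int k) = int m"
proof
  assume "\<exists>b\<ge>0. a + of_nat k * b = X * b + of_nat m"
  then obtain b where "a + of_nat k * b = X * b + of_nat m" by blast
  then have "poly (a + of_nat k * b) (int k) = poly (X * b + of_nat m) (int k)" by simp
  then show "poly a (int k) = int m" by simp
next
  assume val: "poly a (int k) = int m"
  define b where "b = synthetic_div a (int k)"
  have "[:- int k, 1:] * b + [:int m:] = a"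
    using synthetic_div_correct'[of "int k" a] val by (simp add: b_def)
  moreover have "[:- int k, 1:] = X - of_nat k" "[:int m:] = of_nat m" by (simp_all add: of_nat_poly)
  ultimately have eq: "(X - of_nat k) * b + of_nat m = a" by simp
  have "0 \<le> b"
  proof (rule ccontr)
    assume "\<not> 0 \<le> b"
    then have "b + 1 \<le> 0" by (intro int_poly_less_imp_add1_le) simp
    then have "(X - of_nat k) * (b + 1) \<le> 0"
      using of_nat_less_X[of k] by (intro mult_nonneg_nonpos) auto
    moreover have "(X - of_nat k) * (b + 1) = (X - of_nat k) * b + (X - of_nat k)"
      by (simp only: distrib_left mult_1_right)
    ultimately have "a \<le> of_nat (m + k) - X" using eq unfolding of_nat_add by linarith
    then show False using a of_nat_less_X[of "m + k"] by (metis diff_less_0_iff_less not_less order.trans)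
  qed
  moreover have "a + of_nat k * b = X * b + of_nat m" unfolding eq[symmetric] by (simp add: algebra_simps)
  ultimately show "\<exists>b\<ge>0. a + of_nat k * b = X * b + of_nat m" by blast
qed

text \<open>The decoded polynomial and \<open>a\<close> have equal values at almost all
  \<open>k\<close>, so they are equal.\<close>

lemma code_NN:
  assumes a: "0 \<le> a"
  shows "code M NN X (of_nat c) a \<longleftrightarrow> decode c a"
proof -
  have *: "code M NN X (of_nat c) a \<longleftrightarrow>
      (\<forall>\<^sub>F k in sequentially. \<exists>m. horner M NN (of_nat c) (of_nat k) (of_nat m) \<and> poly a (int k) = int m)"
    using value_at[OF a] by (simp add: code_def evtl_NN del: mult_pCons_left)
  show ?thesis
  proof
    assume "code M NN X (of_nat c) a"
    then have ev: "\<forall>\<^sub>F k in sequentially. \<exists>m. horner M NN (of_nat c) (of_nat k) (of_nat m) \<and> poly a (int k) = int m"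
      by (simp add: *)
    then have "\<forall>\<^sub>F k in sequentially. \<exists>m. horner M NN (of_nat c) (of_nat k) (of_nat m)"
      by eventually_elim blast
    then obtain p where p: "decode c p" using horner_decode by blast
    have "\<forall>\<^sub>F k in sequentially. poly p (int k) = poly a (int k)"
      using ev decode_horner[OF p] by eventually_elim auto
    then show "decode c a" using p by (simp add: eventually_poly_eq)
  next
    assume "decode c a"
    then have "\<forall>\<^sub>F k in sequentially. \<exists>m. horner M NN (of_nat c) (of_nat k) (of_nat m) \<and> poly a (int k) = int m"
      using decode_horner[of c a] by (auto elim!: eventually_mono intro: nonneg_int_cases)
    then show "code M NN X (of_nat c) a" by (simp add: *)
  qed
qed

lemma rel_NN:
  assumes "decode c a" "decode c' a'" "decode c'' a''"
    and R: "\<And>m m' m''. R (of_nat m) (of_nat m') (of_nat m'') \<longleftrightarrow> S (int m) (int m') (int m'')"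
  shows "code_rel M NN R (of_nat c) (of_nat c') (of_nat c'') \<longleftrightarrow>
    (\<forall>\<^sub>F k in sequentially. S (poly a (int k)) (poly a' (int k)) (poly a'' (int k)))"
proof -
  have "\<forall>\<^sub>F k in sequentially. (\<exists>m m' m''. horner M NN (of_nat c) (of_nat k) (of_nat m) \<and>
      horner M NN (of_nat c') (of_nat k) (of_nat m') \<and> horner M NN (of_nat c'') (of_nat k) (of_nat m'') \<and>
      R (of_nat m) (of_nat m') (of_nat m'')) \<longleftrightarrow> S (poly a (int k)) (poly a' (int k)) (poly a'' (int k))"
    using decode_horner[OF assms(1)] decode_horner[OF assms(2)] decode_horner[OF assms(3)]
  proof eventually_elim
    case (elim k)
    obtain m m' m'' where "poly a (int k) = int m" "poly a' (int k) = int m'" "poly a'' (int k) = int m''"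
      using elim by (metis nonneg_int_cases)
    then show ?case using elim R by auto
  qed
  then show ?thesis unfolding code_rel_def evtl_NN by (simp add: eventually_subst)
qed

lemma codes_NN: "of_nat c \<in> codes M NN \<longleftrightarrow> (\<exists>p. decode c p)"
proof
  assume "of_nat c \<in> codes M NN"
  then have "\<forall>\<^sub>F k in sequentially. \<exists>m. horner M NN (of_nat c) (of_nat k) (of_nat m)"
    by (auto simp: codes_def code_rel_def evtl_NN elim: eventually_mono)
  then show "\<exists>p. decode c p" by (rule horner_decode)
next
  assume "\<exists>p. decode c p"
  then obtain p where p: "decode c p" by blast
  show "of_nat c \<in> codes M NN"
    using rel_NN[OF p p p, of "\<lambda>_ _ _. True" "\<lambda>_ _ _. True"] by (simp add: codes_def)
qed

text \<open>\<open>R\<close> occurs in two roles: between values it is the integer relation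
  \<open>S\<close>, and between polynomials it is the truth of \<open>S\<close> at almost all
  \<open>k\<close>.\<close>

lemma code_respects_NN:
  assumes R: "\<And>m m' m''. R (of_nat m) (of_nat m') (of_nat m'') \<longleftrightarrow> S (int m) (int m') (int m'')"
    and S: "\<And>a a' a''. (\<forall>\<^sub>F k in sequentially. S (poly a (int k)) (poly a' (int k)) (poly a'' (int k))) \<longleftrightarrow> R a a' a''"
  shows "code_respects M NN X R"
  unfolding code_respects_def using rel_NN[where R = R and S = S] R S by (auto simp: code_NN)

lemma good_NN: "good M NN X"
proof -
  have "\<exists>c\<in>codes M NN. code M NN X c a" if "a \<in> universe M" for a
  proof -
    have "0 \<le> a" using that by simp
    then obtain c where "decode c a" using decode_exists by blast
    then show ?thesis using \<open>0 \<le> a\<close> by (intro bexI[of _ "of_nat c"]) (auto simp: code_NN codes_NN)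
  qed
  moreover have "\<exists>a\<in>universe M. code M NN X c a" if c: "c \<in> codes M NN" for c
  proof -
    obtain n where n: "c = of_nat n" using c by (auto simp: codes_def)
    then obtain p where "decode n p" using c codes_NN by blast
    then show ?thesis using decode_nonneg n by (intro bexI[of _ p]) (auto simp: code_NN)
  qed
  moreover have "code_respects M NN X (\<lambda>a b c. a = b)"
    by (rule code_respects_NN[where S = "\<lambda>a b c. a = b"]) (simp_all add: eventually_poly_eq)
  moreover have "code_respects M NN X (\<lambda>a b c. lt M a b)"
    by (rule code_respects_NN[where S = "\<lambda>a b c. a < b"]) (simp_all add: eventually_poly_less)
  moreover have "code_respects M NN X (\<lambda>a b c. a = zero M)"
    by (rule code_respects_NN[where S = "\<lambda>a b c. a = 0"]) (use eventually_poly_eq[of _ 0] in simp_all)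
  moreover have "code_respects M NN X (\<lambda>a b c. a = one M)"
    by (rule code_respects_NN[where S = "\<lambda>a b c. a = 1"]) (use eventually_poly_eq[of _ 1] in simp_all)
  moreover have "code_respects M NN X (\<lambda>a b c. add M a b = c)"
  proof (rule code_respects_NN[where S = "\<lambda>a b c. a + b = c"])
    show "add M (of_nat m) (of_nat m') = of_nat m'' \<longleftrightarrow> int m + int m' = int m''" for m m' m''
      by (simp only: M_simps of_nat_eq_iff flip: of_nat_add)
    show "(\<forall>\<^sub>F k in sequentially. poly a (int k) + poly a' (int k) = poly a'' (int k)) \<longleftrightarrow> add M a a' = a''" for a a' a''
      using eventually_poly_eq[of "a + a'" a''] by simp
  qed
  moreover have "code_respects M NN X (\<lambda>a b c. mul M a b = c)"
  proof (rule code_respects_NN[where S = "\<lambda>a b c. a * b = c"])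
    show "mul M (of_nat m) (of_nat m') = of_nat m'' \<longleftrightarrow> int m * int m' = int m''" for m m' m''
      by (simp only: M_simps of_nat_eq_iff flip: of_nat_mult)
    show "(\<forall>\<^sub>F k in sequentially. poly a (int k) * poly a' (int k) = poly a'' (int k)) \<longleftrightarrow> mul M a a' = a''" for a a' a''
      using eventually_poly_eq[of "a * a'" a''] by simp
  qed
  ultimately show ?thesis unfolding good_def by blast
qed

section \<open>The theory of the nonnegative polynomials\<close>

lemma holds_Phi_M: "holds M Phi"
  unfolding holds_def sat_Phi using good_NN cut_M theta_X
  by (auto intro!: exI[of _ X] simp: zero_le_poly_iff)

text \<open>The parameter of the cut is the only unboundedly quantified variable, which makes this
  Sigma_1 for every \<open>p\<close>.\<close>

definition sigma_of :: "fm \<Rightarrow> fm" where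
  "sigma_of p = Exists (And (theta_fm (Var 0)) (translate 0 p))"

lemma sentence_sigma_of: "sentence p \<Longrightarrow> sentence (sigma_of p)"
  using fm_below_translate[of 0 p] by (simp add: sentence_def sigma_of_def)

lemma sigma1_sigma_of: "sigma1 (sigma_of p)"
  unfolding sigma_of_def by (intro sigma1.intros delta0.intros delta0_theta_fm delta0_translate)

text \<open>\<open>Phi\<close> provides one \<open>y\<close> that works for all \<open>x\<close>
  satisfying \<open>theta\<close>, so every such \<open>x\<close> gives the translation the truth
  value of \<open>p\<close>.\<close>

lemma holds_sigma_of:
  assumes A: "is_interp A" and Phi: "holds A Phi" and p: "sentence p"
  shows "holds A (sigma_of p) \<longleftrightarrow> (\<exists>x\<in>universe A. theta A x) \<and> holds A p"
proof -
  define e where "e = (\<lambda>_::nat. zero A)"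
  have e: "range e \<subseteq> universe A" using A by (auto simp: e_def is_interp_def)
  obtain y where y: "\<And>x. x \<in> universe A \<Longrightarrow> theta A x \<Longrightarrow> good A (cut A x) y"
    using Phi holds_sentence[OF sentence_Phi e] unfolding sat_Phi by blast
  have "sat A (case_nat x e) (translate 0 p) \<longleftrightarrow> sat A e p" if "x \<in> universe A" "theta A x" for x
    using sat_translate[OF A y[OF that], of 0 p e "case_nat x e"] p e by (simp add: sentence_def)
  then have "sat A e (sigma_of p) \<longleftrightarrow> (\<exists>x\<in>universe A. theta A x) \<and> sat A e p"
    by (auto simp: sigma_of_def)
  then show ?thesis
    using holds_sentence[OF p e] holds_sentence[OF sentence_sigma_of[OF p] e] by simp
qed

lemma sentence_Th: "p \<in> Th A \<Longrightarrow> sentence p"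
  by (simp add: Th_def)

text \<open>\<open>entails\<close> speaks of structures on sets of natural numbers only;
  \<open>entails_any_interp\<close> transfers it to \<open>A\<close>.\<close>

lemma Th_closed:
  assumes "is_interp A" "T \<subseteq> Th A" "sentence p" "entails T p"
  shows "p \<in> Th A"
  using assms entails_any_interp[of T p A] by (auto simp: Th_def)

lemma completion_of_Th:
  fixes A :: "'a interp"
  assumes A: "is_interp A" and T: "T \<subseteq> Th A"
  shows "completion_of T (Th A)"
proof -
  define e where "e = (\<lambda>_::nat. zero A)"
  have e: "range e \<subseteq> universe A" using A by (auto simp: e_def is_interp_def)
  have neg: "Neg p \<in> Th A \<longleftrightarrow> p \<notin> Th A" if "sentence p" for p
  proof -
    have "sentence (Neg p)" using that by (simp add: sentence_def)
    then show ?thesis using that e holds_sentence[of _ e A] by (simp add: Th_def)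
  qed
  have "is_theory (Th A)"
    using Th_closed[OF A order.refl] sentence_Th by (auto simp: is_theory_def)
  moreover have "consistent (Th A)"
    unfolding consistent_def
  proof
    assume "\<exists>p. sentence p \<and> entails (Th A) p \<and> entails (Th A) (Neg p)"
    then obtain p where p: "sentence p" "entails (Th A) p" "entails (Th A) (Neg p)" by blast
    moreover have "sentence (Neg p)" using p(1) by (simp add: sentence_def)
    ultimately show False using neg[OF p(1)] Th_closed[OF A order.refl] by blast
  qed
  moreover have "complete_theory (Th A)"
    unfolding complete_theory_def
  proof (intro allI impI)
    fix p assume "sentence p"
    then have "p \<in> Th A \<or> Neg p \<in> Th A" using neg by blast
    then show "entails (Th A) p \<or> entails (Th A) (Neg p)" by (auto simp: entails_def)
  qed
  ultimately show ?thesis using T by (simp add: completion_of_def)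
qed

theorem theorem4p3:
  shows "completion_of (insert UF PA_minus) (Th ZX_nonneg) \<and>
    (\<exists>\<Phi> S. sentence \<Phi> \<and> (\<forall>\<sigma>\<in>S. sentence \<sigma> \<and> sigma1 \<sigma>) \<and>
      axiomatised_by (Th ZX_nonneg) (insert \<Phi> S))"
proof
  show "completion_of (insert UF PA_minus) (Th ZX_nonneg)"
    using holds_UF_M holds_PA_minus_M sentence_UF sentence_PA_minus
    by (intro completion_of_Th is_interp_M) (auto simp: Th_def)
  \<comment> \<open>These sentences hold in \<open>M\<close> with \<open>X\<close> as witness. In
    any model of \<open>Phi\<close>, conversely, \<open>sigma_of p\<close> implies \<open>p\<close>,
    so every true sentence is recovered.\<close>
  define S where "S = sigma_of ` Th M"
  have S: "sentence \<sigma> \<and> sigma1 \<sigma>" if "\<sigma> \<in> S" for \<sigma>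
    using that sentence_sigma_of sigma1_sigma_of sentence_Th by (auto simp: S_def)
  have theta: "\<exists>x\<in>universe M. theta M x" using theta_X by (intro bexI[of _ X]) (auto simp: zero_le_poly_iff)
  have "holds M \<sigma>" if "\<sigma> \<in> S" for \<sigma>
    using that theta holds_sigma_of[OF is_interp_M holds_Phi_M] by (auto simp: S_def Th_def)
  then have sub: "insert Phi S \<subseteq> Th M"
    using S holds_Phi_M sentence_Phi by (auto simp: Th_def)
  have "entails (insert Phi S) p" if p: "p \<in> Th M" for p
    unfolding entails_def
  proof (intro allI impI)
    fix A :: "nat interp"
    assume A: "is_interp A" "\<forall>q\<in>insert Phi S. holds A q"
    then have "holds A (sigma_of p)" using p by (simp add: S_def)
    then show "holds A p" using holds_sigma_of[of A p] A sentence_Th[OF p] by simp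
  qed
  then have "axiomatised_by (Th ZX_nonneg) (insert Phi S)"
    using Th_closed[OF is_interp_M sub] sentence_Th unfolding axiomatised_by_def by blast
  then show "\<exists>\<Phi> S. sentence \<Phi> \<and> (\<forall>\<sigma>\<in>S. sentence \<sigma> \<and> sigma1 \<sigma>) \<and>
      axiomatised_by (Th ZX_nonneg) (insert \<Phi> S)"
    using S sentence_Phi by blast
qed

end
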